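(* Let $N\ge2$, $p\in(1,+\infty)$, and let $B_1$ be the open unit ball in $\mathbb{R}^N$ centered at the origin. Then the cogenus eigenvalues of the Dirichlet $p$-Laplacian in $B_1$ satisfy $$\lambda_2(p;B_1)\le\dots\le\lambda_{N+1}(p;B_1)\le\lambda_\ominus(p).$$
   Context: For a bounded Lipschitz domain $\Omega\subset\mathbb{R}^N$ let $\mathcal{S}(\Omega)=\{u\in W_0^{1,p}(\Omega):\int_\Omega|u|^p\,dx=1\}$ (with the topology of $W_0^{1,p}(\Omega)$) and $E(u)=\int_\Omega|\nabla u|^p\,dx$. The cogenus eigenvalues are $\lambda_k(p;\Omega)=\inf_h\max_{u\in h(\mathbb{S}^{k-1})}E(u)$, $k\in\mathbb{N}=\{1,2,\dots\}$, the infimum being over all continuous odd maps $h:\mathbb{S}^{k-1}\to\mathcal{S}(\Omega)$, with $\mathbb{S}^{k-1}$ the unit sphere in $\mathbb{R}^k$. In particular $\lambda_1(p;\Omega)=\min_{u\in\mathcal{S}(\Omega)}E(u)$. For $x\in\mathbb{S}^{N-1}$ let $B_1^x=\{z\in B_1:\langle z,x\rangle>0\}$ be a unit half-ball, and set $\lambda_\ominus(p):=\lambda_1(p;B_1^x)$, which does not depend on $x$. (It is an eigenvalue of the $p$-Laplacian in $B_1$ having an eigenfunction whose nodal set is a central section of $B_1$.) *)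

theory Defs
  imports "HOL-Analysis.Analysis"
begin

primrec continuously_differentiable :: "nat \<Rightarrow> ('a::euclidean_space \<Rightarrow> real) \<Rightarrow> bool" where
  "continuously_differentiable 0 f \<longleftrightarrow> continuous_on UNIV f"
| "continuously_differentiable (Suc n) f \<longleftrightarrow>
     (\<forall>x. f differentiable (at x)) \<and>
     (\<forall>b\<in>Basis. continuously_differentiable n (\<lambda>x. frechet_derivative f (at x) b))"

(* The elements of C_c^infinity(\<Omega>) are given on the whole space, extended by zero. *)
definition test_functions :: "'a::euclidean_space set \<Rightarrow> ('a \<Rightarrow> real) set" where
  "test_functions \<Omega> = {\<phi>. (\<forall>n. continuously_differentiable n \<phi>) \<and>
     compact (closure {x. \<phi> x \<noteq> 0}) \<and> closure {x. \<phi> x \<noteq> 0} \<subseteq> \<Omega>}"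

(* Elements of L^p and of the Sobolev spaces are represented by total functions, of which only
   the almost everywhere class on \<Omega> matters. *)
definition Lp :: "real \<Rightarrow> 'a::euclidean_space set \<Rightarrow> ('a \<Rightarrow> 'b::euclidean_space) set" where
  "Lp p \<Omega> = {f. f \<in> borel_measurable (lebesgue_on \<Omega>) \<and>
     integrable (lebesgue_on \<Omega>) (\<lambda>x. norm (f x) powr p)}"

definition is_weak_gradient ::
    "real \<Rightarrow> 'a::euclidean_space set \<Rightarrow> ('a \<Rightarrow> real) \<Rightarrow> ('a \<Rightarrow> 'a) \<Rightarrow> bool" where
  "is_weak_gradient p \<Omega> u g \<longleftrightarrow> u \<in> Lp p \<Omega> \<and> g \<in> Lp p \<Omega> \<and>
     (\<forall>\<phi>\<in>test_functions \<Omega>. \<forall>b\<in>Basis.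
        integral\<^sup>L (lebesgue_on \<Omega>) (\<lambda>x. u x * frechet_derivative \<phi> (at x) b) =
        - integral\<^sup>L (lebesgue_on \<Omega>) (\<lambda>x. (g x \<bullet> b) * \<phi> x))"

definition W1p :: "real \<Rightarrow> 'a::euclidean_space set \<Rightarrow> ('a \<Rightarrow> real) set" where
  "W1p p \<Omega> = {u. \<exists>g. is_weak_gradient p \<Omega> u g}"

(* For open \<Omega> and p \<ge> 1 the weak gradient is unique almost everywhere on \<Omega>, so the choice
   is immaterial. *)
definition weak_gradient ::
    "real \<Rightarrow> 'a::euclidean_space set \<Rightarrow> ('a \<Rightarrow> real) \<Rightarrow> 'a \<Rightarrow> 'a" where
  "weak_gradient p \<Omega> u = (SOME g. is_weak_gradient p \<Omega> u g)"

definition Lp_integral :: "real \<Rightarrow> 'a::euclidean_space set \<Rightarrow> ('a \<Rightarrow> real) \<Rightarrow> real" where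
  "Lp_integral p \<Omega> u = integral\<^sup>L (lebesgue_on \<Omega>) (\<lambda>x. \<bar>u x\<bar> powr p)"

definition dirichlet_energy :: "real \<Rightarrow> 'a::euclidean_space set \<Rightarrow> ('a \<Rightarrow> real) \<Rightarrow> real" where
  "dirichlet_energy p \<Omega> u =
     integral\<^sup>L (lebesgue_on \<Omega>) (\<lambda>x. norm (weak_gradient p \<Omega> u x) powr p)"

definition W1p_norm :: "real \<Rightarrow> 'a::euclidean_space set \<Rightarrow> ('a \<Rightarrow> real) \<Rightarrow> real" where
  "W1p_norm p \<Omega> u = (Lp_integral p \<Omega> u + dirichlet_energy p \<Omega> u) powr (1 / p)"

definition W0p :: "real \<Rightarrow> 'a::euclidean_space set \<Rightarrow> ('a \<Rightarrow> real) set" where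
  "W0p p \<Omega> = {u\<in>W1p p \<Omega>.
     \<forall>e>0. \<exists>\<phi>\<in>test_functions \<Omega>. W1p_norm p \<Omega> (\<lambda>x. u x - \<phi> x) < e}"

(* On representatives the norm is only a seminorm; this is the pullback of the norm topology on
   the space of almost everywhere classes (functions equal almost everywhere are topologically
   indistinguishable). *)
definition W0p_topology :: "real \<Rightarrow> 'a::euclidean_space set \<Rightarrow> ('a \<Rightarrow> real) topology" where
  "W0p_topology p \<Omega> = topology (\<lambda>U. U \<subseteq> W0p p \<Omega> \<and>
     (\<forall>u\<in>U. \<exists>e>0. \<forall>v\<in>W0p p \<Omega>. W1p_norm p \<Omega> (\<lambda>x. v x - u x) < e \<longrightarrow> v \<in> U))"

lemma openin_W0p_topology:
  "openin (W0p_topology p \<Omega>) U \<longleftrightarrow> U \<subseteq> W0p p \<Omega> \<and>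
     (\<forall>u\<in>U. \<exists>e>0. \<forall>v\<in>W0p p \<Omega>. W1p_norm p \<Omega> (\<lambda>x. v x - u x) < e \<longrightarrow> v \<in> U)"
proof -
  let ?P = "\<lambda>U. U \<subseteq> W0p p \<Omega> \<and>
     (\<forall>u\<in>U. \<exists>e>0. \<forall>v\<in>W0p p \<Omega>. W1p_norm p \<Omega> (\<lambda>x. v x - u x) < e \<longrightarrow> v \<in> U)"
  have "istopology ?P"
    unfolding istopology_def
  proof (intro conjI allI impI)
    fix S T assume S: "?P S" and T: "?P T"
    show "S \<inter> T \<subseteq> W0p p \<Omega>" using S by blast
    show "\<forall>u\<in>S \<inter> T. \<exists>e>0. \<forall>v\<in>W0p p \<Omega>. W1p_norm p \<Omega> (\<lambda>x. v x - u x) < e \<longrightarrow> v \<in> S \<inter> T"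
    proof
      fix u assume "u \<in> S \<inter> T"
      with S T obtain d e where
        "d > 0" "\<forall>v\<in>W0p p \<Omega>. W1p_norm p \<Omega> (\<lambda>x. v x - u x) < d \<longrightarrow> v \<in> S"
        "e > 0" "\<forall>v\<in>W0p p \<Omega>. W1p_norm p \<Omega> (\<lambda>x. v x - u x) < e \<longrightarrow> v \<in> T"
        by (metis IntD1 IntD2)
      then show "\<exists>e>0. \<forall>v\<in>W0p p \<Omega>. W1p_norm p \<Omega> (\<lambda>x. v x - u x) < e \<longrightarrow> v \<in> S \<inter> T"
        by (intro exI[of _ "min d e"]) auto
    qed
  next
    fix K assume K: "\<forall>S\<in>K. ?P S"
    then show "\<Union>K \<subseteq> W0p p \<Omega>" by blast
    show "\<forall>u\<in>\<Union>K. \<exists>e>0. \<forall>v\<in>W0p p \<Omega>. W1p_norm p \<Omega> (\<lambda>x. v x - u x) < e \<longrightarrow> v \<in> \<Union>K"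
      using K by (meson UnionE UnionI)
  qed
  then show ?thesis
    unfolding W0p_topology_def by (simp add: topology_inverse')
qed

definition Lp_sphere :: "real \<Rightarrow> 'a::euclidean_space set \<Rightarrow> ('a \<Rightarrow> real) set" where
  "Lp_sphere p \<Omega> = {u\<in>W0p p \<Omega>. Lp_integral p \<Omega> u = 1}"

(* The unit sphere of R^k is nsphere (k - 1), so k \<ge> 1 is understood. *)
definition odd_maps ::
    "nat \<Rightarrow> real \<Rightarrow> 'a::euclidean_space set \<Rightarrow> ((nat \<Rightarrow> real) \<Rightarrow> 'a \<Rightarrow> real) set" where
  "odd_maps k p \<Omega> = {h.
     continuous_map (nsphere (k - 1)) (subtopology (W0p_topology p \<Omega>) (Lp_sphere p \<Omega>)) h \<and>
     (\<forall>s\<in>topspace (nsphere (k - 1)). AE x in lebesgue_on \<Omega>. h (\<lambda>i. - s i) x = - h s x)}"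

(* Extended reals make Inf and Sup total. The Sup is a maximum, since the energy is continuous
   and the sphere is compact. *)
definition cogenus_eigenvalue :: "nat \<Rightarrow> real \<Rightarrow> 'a::euclidean_space set \<Rightarrow> ereal" where
  "cogenus_eigenvalue k p \<Omega> =
     (INF h\<in>odd_maps k p \<Omega>. SUP u\<in>h ` topspace (nsphere (k - 1)). ereal (dirichlet_energy p \<Omega> u))"

definition half_ball :: "'a::euclidean_space \<Rightarrow> 'a set" where
  "half_ball x = {z\<in>ball 0 1. z \<bullet> x > 0}"

(* The first eigenvalue of a half-ball. Its value is the same for all unit vectors x by
   rotation invariance. *)
definition lambda_ominus :: "real \<Rightarrow> 'a::euclidean_space \<Rightarrow> ereal" where
  "lambda_ominus p x = cogenus_eigenvalue 1 p (half_ball x)"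

end

theory Submission
  imports Defs
begin

text \<open>A test function \<open>\<phi>\<close> on a half-ball \<open>B\<^sup>x\<close> has support in \<open>{z. z \<bullet> x > r}\<close> for some \<open>r > 0\<close>, so
  its rotated copy \<open>\<phi>\<^sub>y\<close> lives in every half-ball whose direction is \<open>r\<close>-close to \<open>y\<close>. Let \<open>Y\<close> be a
  finite \<open>r\<close>-net of the sphere. The \<open>p\<close>-means \<open>V(c) = (\<Sum>y\<in>Y. c\<^sub>y \<bar>\<phi>\<^sub>y\<bar>\<^sup>p)\<^bsup>1/p\<^esup>\<close>, for weights \<open>c\<close> of sum \<open>1\<close>,
  have the same \<open>L\<^sup>p\<close> norm as \<open>\<phi>\<close> and, by hidden convexity, energy at most that of \<open>\<phi>\<close>; replacing
  \<open>\<phi>\<^sub>y\<close> by \<open>(\<phi>\<^sub>y\<^sup>2 + \<epsilon>\<^sup>2)\<^bsup>1/2\<^esup>\<close> makes them test functions at the price of an arbitrarily small error.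
  For \<open>s = (\<xi>, t)\<close> in the unit sphere of \<open>\<real>\<^sup>N \<times> \<real>\<close> choose weights \<open>c(s)\<close> continuously, concentrated
  near \<open>y = \<xi> / norm \<xi>\<close> as long as \<open>\<bar>t\<bar> < 1/2\<close>, and a cutoff \<open>a(s) \<ge> 0\<close> vanishing for \<open>t \<le> -1/2\<close>.
  Then \<open>s \<mapsto> a(s) V(c(s)) - a(-s) V(c(-s))\<close> is odd, and its two terms have disjoint supports: either
  one cutoff vanishes, or they live in opposite half-balls. Hence its normalisation is an odd map
  with energy at most that of \<open>\<phi>\<close>, up to the error. Using test functions throughout requires that
  the weak gradient of a test function is its classical gradient, for which the fundamental lemma
  of the calculus of variations is needed.\<close>

subsection \<open>Calculus of smooth functions\<close>

text \<open>The obstacle is continuity in the direction: \<phi> has no symmetry about x, and in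
  general dimension a rotation carrying y to x cannot be chosen continuously over the whole sphere.
  Averaging over a fixed finite family moves weights instead of functions; p-means are the averages
  that neither raise the energy nor lower the mass. The compact support of \<phi> supplies the
  margin r, within which copies of different directions can be mixed and still stay in one
  half-ball. The extra coordinate t, which turns N into N + 1, gives room to pass from a function to
  its negative across \<xi> = 0, where no direction exists: there |t| = 1 and the weights may be
  anything. Any threshold in (0, 1) could replace 1/2, provided cutoffs and weights share it.
  Disjoint supports split mass and energy of the difference into sums bounded with the same factor
  \<open>a(s)^p + a(-s)^p\<close>, which cancels in the quotient. An arbitrary competitor on the
  half-ball can be approximated this way, so neither a first eigenfunction nor its regularity
  enters.\<close>

lemma continuously_differentiable_SucI:
  assumes "\<And>x. (f has_derivative f' x) (at x)"
    and "\<And>b. b \<in> Basis \<Longrightarrow> continuously_differentiable n (\<lambda>x. f' x b)"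
  shows "continuously_differentiable (Suc n) f"
proof -
  have "frechet_derivative f (at x) = f' x" for x
    using frechet_derivative_at[OF assms(1)] by metis
  with assms show ?thesis
    by (auto simp: differentiable_def)
qed

lemma continuously_differentiable_Suc_has_derivative:
  "continuously_differentiable (Suc n) f \<Longrightarrow>
     (f has_derivative frechet_derivative f (at x)) (at x)"
  using frechet_derivative_works by auto

lemma continuously_differentiable_Suc_D:
  "continuously_differentiable (Suc n) f \<Longrightarrow> continuously_differentiable n f"
proof (induction n arbitrary: f)
  case 0
  then show ?case
    by (auto intro!: differentiable_imp_continuous_on simp: differentiable_on_def)
qed simp

lemma continuously_differentiable_imp_continuous:
  "continuously_differentiable n f \<Longrightarrow> continuous_on UNIV f"
  by (induction n) (auto dest: continuously_differentiable_Suc_D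
      simp del: continuously_differentiable.simps(2))

lemma continuously_differentiable_const: "continuously_differentiable n (\<lambda>x. c)"
proof (induction n arbitrary: c)
  case (Suc n)
  show ?case
    by (rule continuously_differentiable_SucI[where f' = "\<lambda>_ _. 0"]) (auto intro: Suc)
qed simp

lemma continuously_differentiable_add:
  "continuously_differentiable n f \<Longrightarrow> continuously_differentiable n g \<Longrightarrow>
     continuously_differentiable n (\<lambda>x. f x + g x)"
proof (induction n arbitrary: f g)
  case (Suc n)
  show ?case
    by (rule continuously_differentiable_SucI[OF has_derivative_add[OF
          Suc.prems[THEN continuously_differentiable_Suc_has_derivative]]])
       (use Suc in auto)
qed (simp add: continuous_on_add)

lemma continuously_differentiable_mult:
  "continuously_differentiable n f \<Longrightarrow> continuously_differentiable n g \<Longrightarrow>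
     continuously_differentiable n (\<lambda>x. f x * g x)"
proof (induction n arbitrary: f g)
  case (Suc n)
  show ?case
    by (rule continuously_differentiable_SucI[OF has_derivative_mult[OF
          Suc.prems[THEN continuously_differentiable_Suc_has_derivative]]])
       (use Suc Suc.prems[THEN continuously_differentiable_Suc_D]
         in \<open>auto intro!: continuously_differentiable_add\<close>)
qed (simp add: continuous_on_mult)

lemma continuously_differentiable_cmult:
  "continuously_differentiable n f \<Longrightarrow> continuously_differentiable n (\<lambda>x. c * f x)"
  by (intro continuously_differentiable_mult continuously_differentiable_const)

lemma continuously_differentiable_diff:
  "continuously_differentiable n f \<Longrightarrow> continuously_differentiable n g \<Longrightarrow>
     continuously_differentiable n (\<lambda>x. f x - g x)"
  using continuously_differentiable_add[OF _ continuously_differentiable_cmult[of n g "-1"]]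
  by simp

lemma continuously_differentiable_sum:
  "(\<And>i. i \<in> I \<Longrightarrow> continuously_differentiable n (f i)) \<Longrightarrow>
     continuously_differentiable n (\<lambda>x. \<Sum>i\<in>I. f i x)"
  by (induction I rule: infinite_finite_induct)
     (auto intro: continuously_differentiable_const continuously_differentiable_add)

lemma continuously_differentiable_prod:
  "(\<And>i. i \<in> I \<Longrightarrow> continuously_differentiable n (f i)) \<Longrightarrow>
     continuously_differentiable n (\<lambda>x. \<Prod>i\<in>I. f i x)"
  by (induction I rule: infinite_finite_induct)
     (auto intro: continuously_differentiable_const continuously_differentiable_mult)

lemma continuously_differentiable_inner:
  "continuously_differentiable n (\<lambda>x. x \<bullet> a)"
proof (cases n)
  case (Suc m)
  show ?thesis
    unfolding Suc
    by (rule continuously_differentiable_SucI[where f' = "\<lambda>_ y. y \<bullet> a"])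
       (auto intro!: derivative_eq_intros continuously_differentiable_const)
qed (auto intro: continuous_intros)

lemma continuously_differentiable_compose_real:
  fixes g :: "real \<Rightarrow> real"
  shows "continuously_differentiable n g \<Longrightarrow> continuously_differentiable n f \<Longrightarrow>
     continuously_differentiable n (\<lambda>x. g (f x))"
proof (induction n arbitrary: g f)
  case 0
  then show ?case
    by (auto intro: continuous_on_compose2)
next
  case (Suc n)
  have "((\<lambda>x. g (f x)) has_derivative
      (\<lambda>h. frechet_derivative g (at (f x)) 1 * frechet_derivative f (at x) h)) (at x)" for x
  proof -
    have g': "(g has_derivative frechet_derivative g (at (f x))) (at (f x))"
      using Suc.prems(1) by (rule continuously_differentiable_Suc_has_derivative)
    define d where "d = frechet_derivative g (at (f x)) 1"
    \<comment> \<open>A linear map on the reals is multiplication by its value at 1. The derivative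
      of the composite thus becomes a product of scalar functions, to which the induction hypothesis
      applies.\<close>
    have "frechet_derivative g (at (f x)) h = d * h" for h
      using linear_cmul[OF has_derivative_linear[OF g'], of h 1] by (simp add: d_def)
    moreover have "((\<lambda>x. g (f x)) has_derivative
        (\<lambda>h. frechet_derivative g (at (f x)) (frechet_derivative f (at x) h))) (at x)"
      using has_derivative_compose[OF
          continuously_differentiable_Suc_has_derivative[OF Suc.prems(2)] g'] .
    ultimately show ?thesis by (simp add: d_def[symmetric])
  qed
  then show ?case
  proof (rule continuously_differentiable_SucI)
    fix b :: 'a assume "b \<in> Basis"
    with Suc.prems have "continuously_differentiable n (\<lambda>x. frechet_derivative f (at x) b)"
      and "continuously_differentiable n (\<lambda>x. frechet_derivative g (at x) 1)" by auto
    with Suc.IH continuously_differentiable_Suc_D[OF Suc.prems(2)]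
    show "continuously_differentiable n
        (\<lambda>x. frechet_derivative g (at (f x)) 1 * frechet_derivative f (at x) b)"
      by (intro continuously_differentiable_mult) auto
  qed
qed

lemma continuously_differentiable_compose_linear:
  fixes L :: "'a::euclidean_space \<Rightarrow> 'b::euclidean_space"
  assumes L: "linear L"
  shows "continuously_differentiable n f \<Longrightarrow> continuously_differentiable n (\<lambda>x. f (L x))"
proof (induction n arbitrary: f)
  case 0
  then show ?case
    using linear_continuous_on[OF linear_conv_bounded_linear[THEN iffD1, OF L]]
    by (auto intro: continuous_on_compose2)
next
  case (Suc n)
  have D: "(f has_derivative frechet_derivative f (at y)) (at y)" for y
    using Suc.prems by (rule continuously_differentiable_Suc_has_derivative)
  have "((\<lambda>x. f (L x)) has_derivative (\<lambda>h. frechet_derivative f (at (L x)) (L h))) (at x)" for x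
    using has_derivative_compose[OF linear_imp_has_derivative[OF L] D] .
  then show ?case
  proof (rule continuously_differentiable_SucI)
    fix b :: 'a
    \<comment> \<open>Smoothness is recorded only for derivatives along basis vectors, and
      \<open>L b\<close> need not be one; linearity of the derivative expands it in the
      basis.\<close>
    have "frechet_derivative f (at y) (L b) =
        (\<Sum>i\<in>Basis. (L b \<bullet> i) * frechet_derivative f (at y) i)" for y
    proof -
      have lin: "linear (frechet_derivative f (at y))"
        using D has_derivative_linear by blast
      have "frechet_derivative f (at y) (L b) =
          frechet_derivative f (at y) (\<Sum>i\<in>Basis. (L b \<bullet> i) *\<^sub>R i)"
        by (simp add: euclidean_representation)
      then show ?thesis
        by (simp add: linear_sum[OF lin] linear_cmul[OF lin])
    qed
    moreover have "continuously_differentiable n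
        (\<lambda>x. \<Sum>i\<in>Basis. (L b \<bullet> i) * frechet_derivative f (at (L x)) i)"
      using Suc by (intro continuously_differentiable_sum continuously_differentiable_cmult) auto
    ultimately show "continuously_differentiable n (\<lambda>x. frechet_derivative f (at (L x)) (L b))"
      by simp
  qed
qed

text \<open>The derivative of \<open>f x powr a\<close> carries the exponent \<open>a - 1\<close>,
  so the induction is over all real exponents; positivity of \<open>f\<close> keeps every one of
  them smooth.\<close>

lemma continuously_differentiable_powr:
  assumes pos: "\<And>x. f x > 0"
  shows "continuously_differentiable n f \<Longrightarrow> continuously_differentiable n (\<lambda>x. f x powr a)"
proof (induction n arbitrary: a)
  case 0
  then show ?case
    using pos by (auto intro!: continuous_intros simp: less_imp_neq[THEN not_sym])
next
  case (Suc n)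
  have "((\<lambda>x. f x powr a) has_derivative
      (\<lambda>h. a * (f x powr (a - 1) * frechet_derivative f (at x) h))) (at x)" for x
  proof -
    have "((\<lambda>t. t powr a) has_derivative (\<lambda>h. (a * f x powr (a - 1)) * h)) (at (f x))"
      using has_real_derivative_powr[OF pos[of x], of a] by (simp add: has_field_derivative_def)
    from has_derivative_compose[OF
        continuously_differentiable_Suc_has_derivative[OF Suc.prems] this]
    show ?thesis by (simp add: mult.assoc)
  qed
  then show ?case
    by (rule continuously_differentiable_SucI)
       (use Suc continuously_differentiable_Suc_D[OF Suc.prems] in
         \<open>auto intro!: continuously_differentiable_cmult continuously_differentiable_mult\<close>)
qed

section \<open>Flat functions and smooth bumps\<close>

lemma continuously_differentiable_Suc_real:
  fixes g :: "real \<Rightarrow> real"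
  assumes "\<And>x. (g has_real_derivative g' x) (at x)" and "continuously_differentiable n g'"
  shows "continuously_differentiable (Suc n) g"
  by (rule continuously_differentiable_SucI[where f' = "\<lambda>x h. g' x * h"])
     (use assms in \<open>auto simp: has_field_derivative_def\<close>)

text \<open>The classical flat function is the case \<open>k = 0\<close>. The powers of
  \<open>t\<close> in the denominator are what differentiation produces: the family over all
  \<open>k\<close> is closed under it up to linear combinations. The rate \<open>c\<close> tends to
  0 when bumps have to fill up an indicator function.\<close>

definition exp_bump :: "real \<Rightarrow> nat \<Rightarrow> real \<Rightarrow> real" where
  "exp_bump c k t = (if t > 0 then exp (- c / t) / t ^ k else 0)"

lemma exp_bump_le:
  assumes "c > 0"
  shows "\<bar>exp_bump c k t\<bar> \<le> fact (k + 2) / c ^ (k + 2) * t\<^sup>2"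
proof (cases "t > 0")
  case True
  have "(c / t) ^ (k + 2) / fact (k + 2) \<le> exp (c / t)"
  proof -
    \<comment> \<open>One term of the exponential series suffices; degree \<open>k + 2\<close>
      absorbs the factor \<open>t ^ k\<close> and leaves the square needed to differentiate at
      0.\<close>
    have "(\<Sum>n\<in>{k + 2}. (c / t) ^ n /\<^sub>R fact n) \<le> exp (c / t)"
      unfolding exp_def using True assms
      by (intro sum_le_suminf summable_exp_generic) auto
    then show ?thesis by (simp add: divide_inverse mult.commute)
  qed
  then have "exp (- c / t) \<le> fact (k + 2) / (c / t) ^ (k + 2)"
    using le_imp_inverse_le[of "(c / t) ^ (k + 2) / fact (k + 2)" "exp (c / t)"] True assms
    by (simp add: exp_minus del: power_add fact_Suc add_2_eq_Suc' power_Suc)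
  then have "exp (- c / t) / t ^ k \<le> fact (k + 2) / (c / t) ^ (k + 2) / t ^ k"
    using True by (intro divide_right_mono) auto
  also have "\<dots> = fact (k + 2) / c ^ (k + 2) * t\<^sup>2"
    using True assms by (simp add: power_divide power_add power2_eq_square)
  finally show ?thesis using True by (simp add: exp_bump_def)
next
  case False
  then show ?thesis using assms by (simp add: exp_bump_def)
qed

lemma DERIV_exp_bump:
  assumes "c > 0"
  shows "(exp_bump c k has_real_derivative
     c * exp_bump c (k + 2) t - k * exp_bump c (k + 1) t) (at t)"
proof (cases t "0::real" rule: linorder_cases)
  case less
  have "((\<lambda>_. 0) has_real_derivative 0) (at t)" by simp
  moreover have "\<forall>\<^sub>F s in nhds t. s < 0"
    using less eventually_nhds_in_open[of "{..<0}" t] by simp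
  then have "\<forall>\<^sub>F s in nhds t. 0 = exp_bump c k s"
    by eventually_elim (simp add: exp_bump_def)
  ultimately show ?thesis
    using less by (simp add: DERIV_cong_ev exp_bump_def)
next
  case equal
  define K where "K = (fact (k + 2) / c ^ (k + 2) :: real)"
  have K: "\<bar>exp_bump c k h\<bar> \<le> K * h\<^sup>2" for h
    unfolding K_def by (rule exp_bump_le[OF assms])
  \<comment> \<open>The quadratic bound makes the difference quotient at 0 at most
    \<open>K * \<bar>h\<bar>\<close>, on both sides of 0.\<close>
  have "((\<lambda>h. exp_bump c k h / h) \<longlongrightarrow> 0) (at 0)"
  proof (rule Lim_null_comparison)
    show "\<forall>\<^sub>F h in at 0. norm (exp_bump c k h / h) \<le> K * \<bar>h\<bar>"
    proof (rule always_eventually, rule allI)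
      fix h :: real
      show "norm (exp_bump c k h / h) \<le> K * \<bar>h\<bar>"
        using K[of h] by (cases "h = 0") (auto simp: field_simps power2_eq_square abs_mult)
    qed
    show "((\<lambda>h. K * \<bar>h\<bar>) \<longlongrightarrow> 0) (at 0)"
      by (intro tendsto_eq_intros) auto
  qed
  then show ?thesis
    using equal by (simp add: has_field_derivative_iff exp_bump_def)
next
  case greater
  have "((\<lambda>t. exp (- c / t)) has_real_derivative exp (- c / t) * (c / t\<^sup>2)) (at t)"
    using greater by (auto intro!: derivative_eq_intros simp: power2_eq_square)
  moreover have "((\<lambda>t. inverse t ^ k) has_real_derivative - (k * inverse t ^ (k + 1))) (at t)"
  proof (cases k)
    case (Suc m)
    have "((\<lambda>t. inverse t ^ Suc m) has_real_derivative
        real (Suc m) * ((- (inverse t ^ 2)) * inverse t ^ m)) (at t)"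
      using DERIV_power_Suc[OF DERIV_inverse[of t], of m] greater
      by (simp add: numeral_2_eq_2 mult_ac)
    then show ?thesis by (simp add: Suc power2_eq_square mult_ac)
  qed simp
  ultimately have "((\<lambda>t. exp (- c / t) * inverse t ^ k) has_real_derivative
      exp (- c / t) * (c / t\<^sup>2) * inverse t ^ k +
      - (k * inverse t ^ (k + 1)) * exp (- c / t)) (at t)"
    by (rule DERIV_mult)
  moreover have "exp (- c / t) * (c / t\<^sup>2) * inverse t ^ k +
      - (k * inverse t ^ (k + 1)) * exp (- c / t) =
      c * exp_bump c (k + 2) t - k * exp_bump c (k + 1) t"
    using greater by (simp add: exp_bump_def power_add power2_eq_square divide_inverse
        power_inverse mult_ac)
  ultimately have "((\<lambda>t. exp (- c / t) / t ^ k) has_real_derivative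
     c * exp_bump c (k + 2) t - k * exp_bump c (k + 1) t) (at t)"
    by (simp add: divide_inverse power_inverse)
  moreover have "\<forall>\<^sub>F s in nhds t. s > 0"
    using greater eventually_nhds_in_open[of "{0<..}" t] by simp
  then have "\<forall>\<^sub>F s in nhds t. exp (- c / s) / s ^ k = exp_bump c k s"
    by eventually_elim (simp add: exp_bump_def)
  ultimately show ?thesis
    by (simp add: DERIV_cong_ev)
qed

lemma continuously_differentiable_exp_bump:
  assumes "c > 0"
  shows "continuously_differentiable n (exp_bump c k)"
proof (induction n arbitrary: k)
  case 0
  have "isCont (exp_bump c k) t" for t
    using DERIV_exp_bump[OF assms] by (rule DERIV_isCont)
  then show ?case by (simp add: continuous_on_eq_continuous_at)
next
  case (Suc n)
  show ?case
    by (rule continuously_differentiable_Suc_real[OF DERIV_exp_bump[OF assms]])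
       (intro continuously_differentiable_diff continuously_differentiable_cmult Suc)
qed

text \<open>Smooth, with values in [0, 1], zero off the open box and convergent to its indicator as
  \<open>c\<close> tends to 0: these approximate integrals over boxes.\<close>

definition box_bump :: "real \<Rightarrow> 'a::euclidean_space \<Rightarrow> 'a \<Rightarrow> 'a \<Rightarrow> real" where
  "box_bump c a b x = (\<Prod>i\<in>Basis. exp_bump c 0 (x \<bullet> i - a \<bullet> i) * exp_bump c 0 (b \<bullet> i - x \<bullet> i))"

lemma exp_bump_0_bounds: "c > 0 \<Longrightarrow> 0 \<le> exp_bump c 0 t \<and> exp_bump c 0 t \<le> 1"
  by (simp add: exp_bump_def)

lemma box_bump_bounds: 
  assumes "c > 0" shows "0 \<le> box_bump c a b x" "box_bump c a b x \<le> 1"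
  using exp_bump_0_bounds[OF assms] unfolding box_bump_def
  by (simp_all add: prod_nonneg prod_le_1 mult_le_one)

lemma box_bump_eq_0: "x \<notin> box a b \<Longrightarrow> box_bump c a b x = 0"
  by (force simp: box_bump_def mem_box exp_bump_def)

lemma box_bump_tendsto_indicator:
  "(\<lambda>n. box_bump (inverse (real (Suc n))) a b x) \<longlonglongrightarrow> indicator (box a b) x"
proof (cases "x \<in> box a b")
  case True
  have "(\<lambda>n. exp_bump (inverse (real (Suc n))) 0 t) \<longlonglongrightarrow> 1" if "t > 0" for t
  proof -
    have "(\<lambda>n. exp (- inverse (real (Suc n)) / t)) \<longlonglongrightarrow> exp (- 0 / t)"
      using that by (intro tendsto_intros LIMSEQ_inverse_real_of_nat) auto
    then show ?thesis using that by (simp add: exp_bump_def)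
  qed
  then have "(\<lambda>n. box_bump (inverse (real (Suc n))) a b x) \<longlonglongrightarrow> (\<Prod>i\<in>(Basis::'a set). 1 * 1)"
    unfolding box_bump_def using True by (intro tendsto_intros) (auto simp: mem_box)
  then show ?thesis using True by simp
qed (simp add: box_bump_eq_0)

lemma continuously_differentiable_box_bump:
  "c > 0 \<Longrightarrow> continuously_differentiable n (box_bump c a b)"
  unfolding box_bump_def[abs_def]
  by (intro continuously_differentiable_prod continuously_differentiable_mult
      continuously_differentiable_compose_real[OF continuously_differentiable_exp_bump]
      continuously_differentiable_diff continuously_differentiable_inner
      continuously_differentiable_const)

subsection \<open>Test functions and rotation invariance of Lebesgue measure\<close>

text \<open>Any compact set outside which the function vanishes will do, so closures of supports
  need not be computed.\<close>

lemma test_functionsI: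
  assumes "\<And>n. continuously_differentiable n \<phi>"
    and K: "compact K" "K \<subseteq> \<Omega>" "\<And>x. x \<notin> K \<Longrightarrow> \<phi> x = 0"
  shows "\<phi> \<in> test_functions \<Omega>"
proof -
  have "closure {x. \<phi> x \<noteq> 0} \<subseteq> K"
    using K by (intro closure_minimal) (auto simp: compact_imp_closed)
  moreover have "bounded (closure {x. \<phi> x \<noteq> 0})"
    using calculation K(1) bounded_subset compact_imp_bounded by blast
  ultimately show ?thesis
    using assms unfolding test_functions_def by (auto simp: compact_eq_bounded_closed)
qed

lemma test_functions_smooth: "\<phi> \<in> test_functions \<Omega> \<Longrightarrow> continuously_differentiable n \<phi>"
  by (simp add: test_functions_def)

lemma test_functions_support:
  assumes "\<phi> \<in> test_functions \<Omega>"
  obtains K where "compact K" "K \<subseteq> \<Omega>" "\<And>x. x \<notin> K \<Longrightarrow> \<phi> x = 0"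
proof (rule that[of "closure {x. \<phi> x \<noteq> 0}"])
  show "\<phi> x = 0" if "x \<notin> closure {x. \<phi> x \<noteq> 0}" for x
    using that closure_subset[of "{x. \<phi> x \<noteq> 0}"] by auto
qed (use assms in \<open>auto simp: test_functions_def\<close>)

lemma test_functions_cmult:
  assumes "\<phi> \<in> test_functions \<Omega>"
  shows "(\<lambda>x. c * \<phi> x) \<in> test_functions \<Omega>"
  using assms
  by (rule test_functions_support, intro test_functionsI)
     (auto intro: continuously_differentiable_cmult test_functions_smooth assms)

lemma test_functions_mult:
  assumes "\<phi> \<in> test_functions \<Omega>" and "\<And>n. continuously_differentiable n \<psi>"
  shows "(\<lambda>x. \<phi> x * \<psi> x) \<in> test_functions \<Omega>"
  using assms(1)
  by (rule test_functions_support, intro test_functionsI)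
     (auto intro: continuously_differentiable_mult test_functions_smooth assms)

lemma test_functions_diff:
  assumes "\<phi> \<in> test_functions \<Omega>" "\<psi> \<in> test_functions \<Omega>"
  shows "(\<lambda>x. \<phi> x - \<psi> x) \<in> test_functions \<Omega>"
proof -
  obtain K L where "compact K" "K \<subseteq> \<Omega>" "\<And>x. x \<notin> K \<Longrightarrow> \<phi> x = 0"
      "compact L" "L \<subseteq> \<Omega>" "\<And>x. x \<notin> L \<Longrightarrow> \<psi> x = 0"
    using assms[THEN test_functions_support] by metis
  then show ?thesis
    by (intro test_functionsI[of _ "K \<union> L"] continuously_differentiable_diff)
       (auto intro: assms[THEN test_functions_smooth])
qed

section \<open>Classical gradients\<close>

definition gradient :: "('a::euclidean_space \<Rightarrow> real) \<Rightarrow> 'a \<Rightarrow> 'a" where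
  "gradient f x = (\<Sum>b\<in>Basis. frechet_derivative f (at x) b *\<^sub>R b)"

lemma gradient_inner_Basis: "b \<in> Basis \<Longrightarrow> gradient f x \<bullet> b = frechet_derivative f (at x) b"
  by (simp add: gradient_def inner_sum_left_Basis)

lemma gradient_eqI:
  assumes "(f has_derivative (\<lambda>h. v \<bullet> h)) (at x)"
  shows "gradient f x = v"
  using frechet_derivative_at[OF assms, symmetric]
  by (simp add: gradient_def euclidean_representation)

lemma has_derivative_gradient:
  assumes "f differentiable (at x)"
  shows "(f has_derivative (\<lambda>h. gradient f x \<bullet> h)) (at x)"
proof -
  have D: "(f has_derivative frechet_derivative f (at x)) (at x)"
    using assms frechet_derivative_works by blast
  note lin = has_derivative_linear[OF D]
  have "frechet_derivative f (at x) h = gradient f x \<bullet> h" for h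
  proof -
    have "frechet_derivative f (at x) h =
        frechet_derivative f (at x) (\<Sum>b\<in>Basis. (h \<bullet> b) *\<^sub>R b)"
      by (simp add: euclidean_representation)
    also have "\<dots> = gradient f x \<bullet> h"
      by (simp add: linear_sum[OF lin] linear_cmul[OF lin] gradient_def inner_sum_left inner_sum_right
          inner_commute mult.commute)
    finally show ?thesis .
  qed
  then have "frechet_derivative f (at x) = (\<lambda>h. gradient f x \<bullet> h)" by blast
  with D show ?thesis by simp
qed

lemma smooth_differentiable:
  "continuously_differentiable (Suc n) f \<Longrightarrow> f differentiable (at x)"
  by simp

lemma continuous_gradient:
  assumes "continuously_differentiable (Suc n) f"
  shows "continuous_on S (gradient f)"
proof -
  have "continuous_on UNIV (gradient f)"
    unfolding gradient_def[abs_def]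
    using assms by (intro continuous_intros) (auto intro: continuously_differentiable_imp_continuous)
  then show ?thesis using continuous_on_subset by blast
qed

lemma gradient_diff:
  assumes "f differentiable (at x)" "g differentiable (at x)"
  shows "gradient (\<lambda>x. f x - g x) x = gradient f x - gradient g x"
  by (rule gradient_eqI, unfold inner_diff_left)
     (intro has_derivative_diff has_derivative_gradient assms)

lemma gradient_cmult:
  assumes "f differentiable (at x)"
  shows "gradient (\<lambda>x. c * f x) x = c *\<^sub>R gradient f x"
  by (rule gradient_eqI) (use has_derivative_mult_right[OF has_derivative_gradient[OF assms]] in simp)

lemma gradient_compose_orthogonal:
  fixes R :: "'a::euclidean_space \<Rightarrow> 'a"
  assumes "f differentiable (at (R x))" and R: "orthogonal_transformation R"
  shows "norm (gradient (\<lambda>x. f (R x)) x) = norm (gradient f (R x))"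
proof -
  \<comment> \<open>\<open>v\<close> is the gradient rotated back; as
    \<open>R v \<bullet> R h = v \<bullet> h\<close>, it is the gradient of the composite, and
    \<open>R\<close> preserves its norm.\<close>
  obtain v where v: "R v = gradient f (R x)"
    using orthogonal_transformation_surj[OF R] by (metis surjD)
  have "((\<lambda>x. f (R x)) has_derivative (\<lambda>h. gradient f (R x) \<bullet> R h)) (at x)"
    using has_derivative_compose[where f = R and f' = R, OF _ has_derivative_gradient[OF assms(1)]]
      linear_imp_has_derivative[of R "at x"] R
    by (simp add: orthogonal_transformation_def)
  then have "((\<lambda>x. f (R x)) has_derivative (\<lambda>h. v \<bullet> h)) (at x)"
    using R unfolding v[symmetric] orthogonal_transformation_def by simp
  then have "gradient (\<lambda>x. f (R x)) x = v" by (rule gradient_eqI)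
  then show ?thesis
    using orthogonal_transformation_norm[OF R] v by metis
qed

lemma gradient_eq_0_outside:
  fixes f :: "'a::euclidean_space \<Rightarrow> real"
  assumes K: "closed K" "\<And>x. x \<notin> K \<Longrightarrow> f x = 0" and "x \<notin> K"
  shows "gradient f x = 0"
proof (rule gradient_eqI)
  have "((\<lambda>_. 0) has_derivative (\<lambda>h. 0 \<bullet> h)) (at x)" by simp
  then show "(f has_derivative (\<lambda>h. 0 \<bullet> h)) (at x)"
    by (rule has_derivative_transform_within_open[of _ _ _ _ "- K"])
       (use K \<open>x \<notin> K\<close> in auto)
qed

lemma frechet_derivative_eq_0_outside:
  fixes f :: "'a::euclidean_space \<Rightarrow> real"
  assumes "closed K" "\<And>x. x \<notin> K \<Longrightarrow> f x = 0" and "x \<notin> K" "b \<in> Basis"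
  shows "frechet_derivative f (at x) b = 0"
  using gradient_eq_0_outside[of K f x] assms(1-3) gradient_inner_Basis[OF assms(4), of f x] by auto

lemma test_functions_frechet_derivative:
  assumes "\<phi> \<in> test_functions \<Omega>" and b: "b \<in> Basis"
  shows "(\<lambda>x. frechet_derivative \<phi> (at x) b) \<in> test_functions \<Omega>"
proof -
  obtain K where K: "compact K" "K \<subseteq> \<Omega>" "\<And>x. x \<notin> K \<Longrightarrow> \<phi> x = 0"
    using assms(1) by (rule test_functions_support) blast
  show ?thesis
  proof (rule test_functionsI[OF _ K(1,2)])
    show "continuously_differentiable n (\<lambda>x. frechet_derivative \<phi> (at x) b)" for n
      using test_functions_smooth[OF assms(1), of "Suc n"] b by simp
  qed (use K b in \<open>auto intro: frechet_derivative_eq_0_outside compact_imp_closed\<close>)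
qed

section \<open>Lebesgue integrals, translations and rotations\<close>

lemma integrable_compact_support:
  fixes f :: "'a::euclidean_space \<Rightarrow> 'b::{banach, second_countable_topology}"
  assumes "continuous_on UNIV f" "compact K" "\<And>x. x \<notin> K \<Longrightarrow> f x = 0"
  shows "integrable lborel f"
proof -
  have "integrable lborel (\<lambda>x. indicator K x *\<^sub>R f x)"
    using assms continuous_on_subset by (intro borel_integrable_compact) blast+
  moreover have "(\<lambda>x. indicator K x *\<^sub>R f x) = f"
    using assms(3) by (auto simp: indicator_def)
  ultimately show ?thesis by simp
qed

text \<open>The definitions integrate over the completed measure restricted to \<Omega>, while
  Fubini and invariance arguments are run on \<open>lborel\<close>. For Borel functions vanishing
  off the open set the two integrals agree.\<close>

lemma
  fixes f :: "'a::euclidean_space \<Rightarrow> 'b::{banach, second_countable_topology}"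
  assumes "open \<Omega>" "f \<in> borel_measurable borel" "\<And>x. x \<notin> \<Omega> \<Longrightarrow> f x = 0"
  shows integral_lebesgue_on_support: "integral\<^sup>L (lebesgue_on \<Omega>) f = integral\<^sup>L lborel f"
    and integrable_lebesgue_on_support: "integrable (lebesgue_on \<Omega>) f \<longleftrightarrow> integrable lborel f"
proof -
  have eq: "(\<lambda>x. indicator \<Omega> x *\<^sub>R f x) = f"
    using assms(3) by (auto simp: indicator_def)
  have "\<Omega> \<in> sets lebesgue" using assms(1) by auto
  then show "integral\<^sup>L (lebesgue_on \<Omega>) f = integral\<^sup>L lborel f"
    and "integrable (lebesgue_on \<Omega>) f \<longleftrightarrow> integrable lborel f"
    using assms(2)
    by (simp_all add: integral_restrict_space integrable_restrict_space eq
        integral_completion integrable_completion)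
qed

lemma nn_integral_lborel_translate:
  fixes f :: "'a::euclidean_space \<Rightarrow> ennreal"
  assumes "f \<in> borel_measurable borel"
  shows "(\<integral>\<^sup>+x. f (c + x) \<partial>lborel) = integral\<^sup>N lborel f"
proof -
  have "integral\<^sup>N lborel f = integral\<^sup>N (distr lborel borel ((+) c)) f"
    by (simp add: lborel_distr_plus)
  also have "\<dots> = (\<integral>\<^sup>+x. f (c + x) \<partial>lborel)"
    using assms by (subst nn_integral_distr) auto
  finally show ?thesis by simp
qed

text \<open>The uniqueness argument for Haar measure, applied to Lebesgue measure and its image under
  \<open>R\<close>: the double integral of \<open>1\<^bsub>ball 0 1\<^esub>(y) 1\<^bsub>B\<^esub>(y + R x)\<close> is evaluated in both orders.\<close>
lemma lborel_distr_orthogonal: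
  fixes R :: "'a::euclidean_space \<Rightarrow> 'a"
  assumes R: "orthogonal_transformation R"
  shows "distr lborel borel R = lborel"
proof (rule measure_eqI)
  fix B assume "B \<in> sets (distr lborel borel R)"
  then have B[measurable]: "B \<in> sets borel" by simp
  have lin: "linear R" using R by (simp add: orthogonal_transformation_def)
  have R_meas[measurable]: "R \<in> borel_measurable borel"
    using lin by (intro borel_measurable_continuous_onI linear_continuous_on)
      (simp add: linear_conv_bounded_linear)
  \<comment> \<open>\<open>S\<close> inverts \<open>R\<close>: writing
    \<open>y + R x = R (S y + x)\<close> lets translation invariance remove \<open>y\<close> from
    the inner integral in one order of integration.\<close>
  obtain S where S: "\<And>y. R (S y) = y"
    using orthogonal_transformation_surj[OF R] by (metis surjD)
  let ?U = "ball 0 1 :: 'a set"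
  have [measurable]: "?U \<in> sets borel" by simp
  have U: "emeasure lborel ?U \<noteq> 0" "emeasure lborel ?U \<noteq> \<infinity>"
    by (simp_all add: emeasure_ball unit_ball_vol_pos less_imp_neq[THEN not_sym])
  have "(\<integral>\<^sup>+y. \<integral>\<^sup>+x. indicator ?U y * indicator B (y + R x) \<partial>lborel \<partial>lborel) =
      (\<integral>\<^sup>+y. indicator ?U y * (\<integral>\<^sup>+x. indicator B (R (S y + x)) \<partial>lborel) \<partial>lborel)"
    by (simp add: nn_integral_cmult linear_add[OF lin] S)
  also have "\<dots> = (\<integral>\<^sup>+y. indicator ?U y * (\<integral>\<^sup>+x. indicator B (R x) \<partial>lborel) \<partial>lborel)"
    by (subst nn_integral_lborel_translate) auto
  also have "\<dots> = emeasure lborel ?U * (\<integral>\<^sup>+x. indicator B (R x) \<partial>lborel)"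
    by (subst nn_integral_multc) auto
  also have "(\<integral>\<^sup>+x. indicator B (R x) \<partial>lborel) = emeasure (distr lborel borel R) B"
    using nn_integral_distr[of R lborel borel "indicator B"] by simp
  finally have 1: "(\<integral>\<^sup>+y. \<integral>\<^sup>+x. indicator ?U y * indicator B (y + R x) \<partial>lborel \<partial>lborel) =
      emeasure lborel ?U * emeasure (distr lborel borel R) B" .
  have "(\<integral>\<^sup>+y. \<integral>\<^sup>+x. indicator ?U y * indicator B (y + R x) \<partial>lborel \<partial>lborel) =
      (\<integral>\<^sup>+x. \<integral>\<^sup>+y. indicator ?U y * indicator B (y + R x) \<partial>lborel \<partial>lborel)"
    by (rule lborel_pair.Fubini'[symmetric]) measurable
  also have "\<dots> = (\<integral>\<^sup>+x. \<integral>\<^sup>+y. indicator ?U (y - R x) * indicator B y \<partial>lborel \<partial>lborel)"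
  proof (rule nn_integral_cong)
    fix x
    have "(\<integral>\<^sup>+y. (\<lambda>z. indicator ?U (z - R x) * indicator B z) (R x + y) \<partial>lborel) =
        (\<integral>\<^sup>+y. indicator ?U (y - R x) * indicator B y \<partial>lborel)"
      by (rule nn_integral_lborel_translate) measurable
    then show "(\<integral>\<^sup>+y. indicator ?U y * indicator B (y + R x) \<partial>lborel) =
        (\<integral>\<^sup>+y. indicator ?U (y - R x) * indicator B y \<partial>lborel)"
      by (simp add: add.commute)
  qed
  also have "\<dots> = (\<integral>\<^sup>+y. \<integral>\<^sup>+x. indicator ?U (y - R x) * indicator B y \<partial>lborel \<partial>lborel)"
    by (rule lborel_pair.Fubini'[symmetric]) measurable
  also have "\<dots> = (\<integral>\<^sup>+y. emeasure lborel ?U * indicator B y \<partial>lborel)"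
  proof (rule nn_integral_cong)
    fix y
    \<comment> \<open>The isometry enters here: the unit ball is invariant under \<open>R\<close>,
      so the factor is a translated indicator in \<open>x\<close>.\<close>
    have "indicator ?U (y - R x) = (indicator ?U (- S y + x) :: ennreal)" for x
    proof -
      have "norm (y - R x) = norm (R (S y - x))"
        by (simp add: linear_diff[OF lin] S)
      also have "\<dots> = norm (- S y + x)"
        using orthogonal_transformation_norm[OF R] norm_minus_commute[of "S y" x] by simp
      finally show ?thesis by (simp add: indicator_def)
    qed
    then have "(\<integral>\<^sup>+x. indicator ?U (y - R x) \<partial>lborel) = emeasure lborel ?U"
      using nn_integral_lborel_translate[of "indicator ?U" "- S y"] by simp
    then show "(\<integral>\<^sup>+x. indicator ?U (y - R x) * indicator B y \<partial>lborel) =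
        emeasure lborel ?U * indicator B y"
      by (subst nn_integral_multc) auto
  qed
  also have "\<dots> = emeasure lborel ?U * emeasure lborel B"
    by (simp add: nn_integral_cmult)
  finally show "emeasure (distr lborel borel R) B = emeasure lborel B"
    using U unfolding 1 by (simp add: ennreal_mult_cancel_left)
qed simp

lemma integral_lborel_orthogonal:
  fixes f :: "'a::euclidean_space \<Rightarrow> 'b::{banach, second_countable_topology}"
    and R :: "'a \<Rightarrow> 'a"
  assumes "orthogonal_transformation R" and "f \<in> borel_measurable borel"
  shows "(\<integral>x. f (R x) \<partial>lborel) = integral\<^sup>L lborel f"
proof -
  have "R \<in> borel_measurable borel"
    using assms(1) by (intro borel_measurable_continuous_onI linear_continuous_on)
      (simp add: orthogonal_transformation_def linear_conv_bounded_linear)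
  then have "integral\<^sup>L (distr lborel borel R) f = (\<integral>x. f (R x) \<partial>lborel)"
    using assms(2) by (intro integral_distr) auto
  then show ?thesis by (simp add: lborel_distr_orthogonal[OF assms(1)])
qed

subsection \<open>The fundamental lemma of the calculus of variations\<close>

text \<open>\<open>1 - \<Prod>(1 - bump)\<close> is a smooth analogue of the indicator of a union:
  overlaps are not counted twice, the values stay in [0, 1], and dominated convergence passes to the
  limit. The closed boxes lie in \<Omega> so that supports are compact there.\<close>

lemma integral_zero_finite_union_boxes:
  fixes F :: "'a::euclidean_space \<Rightarrow> real"
  assumes F: "integrable lebesgue F"
    and test: "\<And>\<phi>. \<phi> \<in> test_functions \<Omega> \<Longrightarrow> (\<integral>x. \<phi> x * F x \<partial>lebesgue) = 0"
    and I: "finite I" "\<And>i. i \<in> I \<Longrightarrow> cbox (a i) (b i) \<subseteq> \<Omega>"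
  shows "(\<integral>x. indicator (\<Union>i\<in>I. box (a i) (b i)) x * F x \<partial>lebesgue) = 0"
proof -
  define c where "c n = inverse (real (Suc n))" for n
  have c: "c n > 0" for n by (simp add: c_def)
  define \<phi> where "\<phi> n x = 1 - (\<Prod>i\<in>I. 1 - box_bump (c n) (a i) (b i) x)" for n x
  have "\<phi> n \<in> test_functions \<Omega>" for n
  proof (rule test_functionsI)
    show "compact (\<Union>i\<in>I. cbox (a i) (b i))" using I by (intro compact_UN) auto
    show "(\<Union>i\<in>I. cbox (a i) (b i)) \<subseteq> \<Omega>" using I by blast
    show "continuously_differentiable k (\<phi> n)" for k
      unfolding \<phi>_def[abs_def]
      by (intro continuously_differentiable_diff continuously_differentiable_const
          continuously_differentiable_prod continuously_differentiable_box_bump c)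
    show "\<phi> n x = 0" if "x \<notin> (\<Union>i\<in>I. cbox (a i) (b i))" for x
    proof -
      have "box_bump (c n) (a i) (b i) x = 0" if "i \<in> I" for i
        using \<open>x \<notin> _\<close> that box_subset_cbox[of "a i" "b i"] by (intro box_bump_eq_0) blast
      then show ?thesis by (simp add: \<phi>_def)
    qed
  qed
  then have zero: "(\<integral>x. \<phi> n x * F x \<partial>lebesgue) = 0" for n by (rule test)
  have meas: "\<phi> n \<in> borel_measurable lebesgue" for n
  proof -
    have "\<phi> n \<in> borel_measurable borel"
      using \<open>\<phi> n \<in> test_functions \<Omega>\<close>[THEN test_functions_smooth, of 0]
      by (intro borel_measurable_continuous_onI) simp
    then show ?thesis by (simp add: measurable_completion)
  qed
  have bounds: "\<bar>\<phi> n x\<bar> \<le> 1" for n x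
  proof -
    have "0 \<le> (\<Prod>i\<in>I. 1 - box_bump (c n) (a i) (b i) x)"
      using box_bump_bounds[OF c] by (intro prod_nonneg) auto
    moreover have "(\<Prod>i\<in>I. 1 - box_bump (c n) (a i) (b i) x) \<le> 1"
      using box_bump_bounds[OF c] by (intro prod_le_1) auto
    ultimately show ?thesis by (simp add: \<phi>_def)
  qed
  have lim: "(\<lambda>n. \<phi> n x) \<longlonglongrightarrow> indicator (\<Union>i\<in>I. box (a i) (b i)) x" for x
  proof -
    have "(\<lambda>n. \<phi> n x) \<longlonglongrightarrow> 1 - (\<Prod>i\<in>I. 1 - indicator (box (a i) (b i)) x)"
      unfolding \<phi>_def c_def by (intro tendsto_intros box_bump_tendsto_indicator)
    also have "1 - (\<Prod>i\<in>I. 1 - indicator (box (a i) (b i)) x) =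
        (indicator (\<Union>i\<in>I. box (a i) (b i)) x :: real)"
    proof (cases "x \<in> (\<Union>i\<in>I. box (a i) (b i))")
      case True
      then have "(\<Prod>i\<in>I. 1 - indicator (box (a i) (b i)) x :: real) = 0"
        using I(1) by (force simp: prod_zero_iff)
      with True show ?thesis by simp
    next
      case False
      then have "(\<Prod>i\<in>I. 1 - indicator (box (a i) (b i)) x :: real) = (\<Prod>i\<in>I. 1)"
        by (intro prod.cong) auto
      with False show ?thesis by simp
    qed
    finally show ?thesis .
  qed
  have "(\<lambda>n. \<integral>x. \<phi> n x * F x \<partial>lebesgue) \<longlonglongrightarrow>
      (\<integral>x. indicator (\<Union>i\<in>I. box (a i) (b i)) x * F x \<partial>lebesgue)"
  proof (rule integral_dominated_convergence[where w = "\<lambda>x. \<bar>F x\<bar>"])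
    show "(\<lambda>x. indicator (\<Union>i\<in>I. box (a i) (b i)) x * F x) \<in> borel_measurable lebesgue"
    proof (intro borel_measurable_times borel_measurable_indicator borel_measurable_integrable[OF F])
      have "open (\<Union>i\<in>I. box (a i) (b i))" by (intro open_UN) (auto simp: open_box)
      then show "(\<Union>i\<in>I. box (a i) (b i)) \<in> sets lebesgue" by auto
    qed
    show "AE x in lebesgue. norm (\<phi> n x * F x) \<le> \<bar>F x\<bar>" for n
      using bounds by (auto simp: abs_mult intro!: mult_left_le_one_le)
    show "AE x in lebesgue. (\<lambda>n. \<phi> n x * F x) \<longlonglongrightarrow> indicator (\<Union>i\<in>I. box (a i) (b i)) x * F x"
      by (intro AE_I2 tendsto_intros lim)
    show "(\<lambda>x. \<phi> n x * F x) \<in> borel_measurable lebesgue" for n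
      by (intro borel_measurable_times meas borel_measurable_integrable[OF F])
  qed (use F in auto)
  then show ?thesis
    by (simp add: zero LIMSEQ_const_iff)
qed

text \<open>By the Lindelof property an open set is a countable union of open boxes whose closed
  counterparts lie in it; finite partial unions exhaust it, with \<open>\<bar>F x\<bar>\<close> as
  majorant. The boxes may overlap, which is why finite unions and not single boxes were
  treated.\<close>

lemma integral_zero_open:
  fixes F :: "'a::euclidean_space \<Rightarrow> real"
  assumes F: "integrable lebesgue F"
    and test: "\<And>\<phi>. \<phi> \<in> test_functions \<Omega> \<Longrightarrow> (\<integral>x. \<phi> x * F x \<partial>lebesgue) = 0"
    and U: "open U" "U \<subseteq> \<Omega>"
  shows "(\<integral>x. indicator U x * F x \<partial>lebesgue) = 0"
proof (cases "U = {}")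
  case False
  define \<B> where "\<B> = {box a b |a b. cbox a b \<subseteq> U}"
  have Un: "\<Union>\<B> = U"
  proof
    show "\<Union>\<B> \<subseteq> U" using box_subset_cbox by (fastforce simp: \<B>_def)
    show "U \<subseteq> \<Union>\<B>"
    proof
      fix x assume "x \<in> U"
      then obtain a b where "cbox a b \<subseteq> U" "x \<in> box a b"
        using open_contains_cbox[OF U(1)] by metis
      then show "x \<in> \<Union>\<B>" by (auto simp: \<B>_def)
    qed
  qed
  obtain \<B>' where B': "\<B>' \<subseteq> \<B>" "countable \<B>'" "\<Union>\<B>' = U"
    using Lindelof[of \<B>] Un by (auto simp: \<B>_def open_box)
  with False have "\<B>' \<noteq> {}" by auto
  define B where "B = from_nat_into \<B>'"
  have ran: "range B = \<B>'" unfolding B_def using \<open>\<B>' \<noteq> {}\<close> B'(2) by (rule range_from_nat_into)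
  then have "\<forall>n. \<exists>a b. B n = box a b \<and> cbox a b \<subseteq> U"
    using B'(1) unfolding \<B>_def by blast
  then obtain a b where ab: "\<And>n. B n = box (a n) (b n)" "\<And>n. cbox (a n) (b n) \<subseteq> U"
    by metis
  have U_eq: "(\<Union>n. B n) = U" using ran B'(3) by auto
  have zero: "(\<integral>x. indicator (\<Union>i<n. B i) x * F x \<partial>lebesgue) = 0" for n
    using integral_zero_finite_union_boxes[OF F test, where I = "{..<n}" and a = a and b = b] ab U(2) by (simp; blast)
  have "(\<lambda>n. \<integral>x. indicator (\<Union>i<n. B i) x * F x \<partial>lebesgue) \<longlonglongrightarrow>
      (\<integral>x. indicator U x * F x \<partial>lebesgue)"
  proof (rule integral_dominated_convergence[where w = "\<lambda>x. \<bar>F x\<bar>"])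
    show "(\<lambda>x. indicator U x * F x) \<in> borel_measurable lebesgue"
      using U(1)
      by (intro borel_measurable_times borel_measurable_indicator borel_measurable_integrable[OF F]) auto
    show "(\<lambda>x. indicator (\<Union>i<n. B i) x * F x) \<in> borel_measurable lebesgue" for n
    proof (intro borel_measurable_times borel_measurable_indicator borel_measurable_integrable[OF F])
      have "open (\<Union>i<n. B i)" unfolding ab by (intro open_UN) (auto simp: open_box)
      then show "(\<Union>i<n. B i) \<in> sets lebesgue" by auto
    qed
    show "AE x in lebesgue. (\<lambda>n. indicator (\<Union>i<n. B i) x * F x) \<longlonglongrightarrow> indicator U x * F x"
      unfolding U_eq[symmetric] by (intro AE_I2 tendsto_intros LIMSEQ_indicator_UN)
    show "AE x in lebesgue. norm (indicator (\<Union>i<n. B i) x * F x) \<le> \<bar>F x\<bar>" for n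
      by (auto simp: indicator_def)
  qed (use F in auto)
  then show ?thesis
    by (simp add: zero LIMSEQ_const_iff)
qed simp

lemma sigma_finite_lebesgue: "sigma_finite_measure lebesgue"
proof -
  obtain A :: "'a set set" where "countable A" "A \<subseteq> sets lborel" "\<Union>A = space lborel"
      "\<And>a. a \<in> A \<Longrightarrow> emeasure lborel a \<noteq> \<infinity>"
    using lborel.sigma_finite_countable by metis
  then show ?thesis
    by (intro sigma_finite_measure.intro exI[of _ A])
       (auto simp: subset_iff sets_completionI_sets)
qed

text \<open>Open sets are stable under intersection and generate the Borel sets, so the vanishing of
  integrals spreads by a Dynkin class argument, and from Borel to Lebesgue sets because these differ
  by null sets. Zero integrals over all measurable sets force \<open>F\<close> to vanish almost
  everywhere.\<close>

lemma AE_zero_if_integral_zero_open: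
  fixes F :: "'a::euclidean_space \<Rightarrow> real"
  assumes F: "integrable lebesgue F"
    and open_zero: "\<And>U. open U \<Longrightarrow> (\<integral>x. indicator U x * F x \<partial>lebesgue) = 0"
  shows "AE x in lebesgue. F x = 0"
proof (rule sigma_finite_measure.density_zero[OF sigma_finite_lebesgue F])
  have int: "integrable lebesgue (\<lambda>x. indicator A x * F x)" if "A \<in> sets lebesgue" for A
    using integrable_mult_indicator[OF that F] by simp
  have borel: "(\<integral>x. indicator A x * F x \<partial>lebesgue) = 0" if "A \<in> sets borel" for A
  proof -
    have "Int_stable {S :: 'a set. open S}" and "{S :: 'a set. open S} \<subseteq> Pow UNIV"
      and "A \<in> sigma_sets UNIV {S. open S}"
      using that unfolding borel_def by (auto simp: sets_measure_of Int_stable_def)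
    then show ?thesis
    proof (induction rule: sigma_sets_induct_disjoint)
      case (basic A)
      then show ?case using open_zero by simp
    next
      case empty
      then show ?case by simp
    next
      case (compl A)
      then have A: "A \<in> sets lebesgue"
        by (intro sets_completionI_sets) (simp add: borel_def)
      have "(\<integral>x. indicator (UNIV - A) x * F x \<partial>lebesgue) =
          (\<integral>x. indicator UNIV x * F x - indicator A x * F x \<partial>lebesgue)"
        by (intro Bochner_Integration.integral_cong) (auto simp: indicator_def)
      also have "\<dots> = 0"
        using compl open_zero[of UNIV] int[OF A] int[of UNIV]
        by (subst Bochner_Integration.integral_diff) auto
      finally show ?case .
    next
      case (union A)
      then have A: "A i \<in> sets lebesgue" for i
        by (intro sets_completionI_sets) (auto simp: borel_def)
      have "(\<integral>x. indicator (\<Union>i. A i) x *\<^sub>R F x \<partial>lebesgue) =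
          (\<Sum>i. \<integral>x. indicator (A i) x *\<^sub>R F x \<partial>lebesgue)"
        using lebesgue_integral_countable_add[of A lebesgue F] A union(1)
          integrable_mult_indicator[OF _ F, of "\<Union>i. A i"]
        unfolding set_lebesgue_integral_def set_integrable_def
        by (auto simp: disjoint_family_on_def)
      with union show ?case by simp
    qed
  qed
  fix A assume "A \<in> sets (lebesgue :: 'a measure)"
  then obtain S N N' where A: "A = S \<union> N" "N \<subseteq> N'" "N' \<in> null_sets lborel" "S \<in> sets lborel"
    by (rule sets_completionE)
  then have "AE x in lebesgue. x \<notin> N'"
    by (intro AE_not_in null_sets_completionI)
  then have "AE x in lebesgue. indicator A x *\<^sub>R F x = indicator S x * F x"
    by eventually_elim (use A in \<open>auto simp: indicator_def\<close>)
  moreover have "S \<in> sets lebesgue" using A(4) by auto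
  ultimately have "(\<integral>x. indicator A x *\<^sub>R F x \<partial>lebesgue) = (\<integral>x. indicator S x * F x \<partial>lebesgue)"
    using int[of S] int[OF \<open>A \<in> sets lebesgue\<close>]
    by (intro integral_cong_AE) auto
  then show "set_lebesgue_integral lebesgue A F = 0"
    using borel[of S] A(4) by (simp add: set_lebesgue_integral_def)
qed

lemma AE_zero_if_integral_zero_test_functions:
  fixes f :: "'a::euclidean_space \<Rightarrow> real"
  assumes \<Omega>: "open \<Omega>" and f: "integrable (lebesgue_on \<Omega>) f"
    and test: "\<And>\<phi>. \<phi> \<in> test_functions \<Omega> \<Longrightarrow> (\<integral>x. f x * \<phi> x \<partial>lebesgue_on \<Omega>) = 0"
  shows "AE x in lebesgue_on \<Omega>. f x = 0"
proof -
  define F where "F x = indicator \<Omega> x * f x" for x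
  have \<Omega>': "\<Omega> \<in> sets lebesgue" using \<Omega> by auto
  have F: "integrable lebesgue F"
    using f \<Omega>' by (simp add: F_def[abs_def] integrable_restrict_space)
  have "(\<integral>x. \<phi> x * F x \<partial>lebesgue) = 0" if "\<phi> \<in> test_functions \<Omega>" for \<phi>
    using test[OF that] \<Omega>' by (simp add: F_def integral_restrict_space mult_ac)
  then have open_zero: "(\<integral>x. indicator U x * F x \<partial>lebesgue) = 0" if "open U" "U \<subseteq> \<Omega>" for U
    using integral_zero_open[OF F _ that] by blast
  have "(\<integral>x. indicator U x * F x \<partial>lebesgue) = 0" if "open U" for U
  proof -
    have "(\<lambda>x. indicator U x * F x) = (\<lambda>x. indicator (U \<inter> \<Omega>) x * F x)"
      by (auto simp: F_def indicator_def)
    then show ?thesis using open_zero[of "U \<inter> \<Omega>"] that \<Omega> by (simp add: open_Int)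
  qed
  from AE_zero_if_integral_zero_open[OF F this]
  have "AE x in lebesgue. F x = 0" .
  then show ?thesis
    using \<Omega>' by (subst AE_restrict_space_iff) (auto simp: F_def indicator_def)
qed

lemma compact_support_bounded:
  fixes f :: "'a::euclidean_space \<Rightarrow> 'b::real_normed_vector"
  assumes "continuous_on UNIV f" "compact K" "\<And>x. x \<notin> K \<Longrightarrow> f x = 0"
  obtains C where "C \<ge> 0" "\<And>x. norm (f x) \<le> C"
proof -
  have "compact (f ` K)"
    using assms(1,2) continuous_on_subset by (intro compact_continuous_image) auto
  then obtain C where "\<And>y. y \<in> f ` K \<Longrightarrow> norm y \<le> C"
    using compact_imp_bounded bounded_iff by metis
  then have "norm (f x) \<le> max 0 C" for x
    using assms(3)[of x] by (cases "x \<in> K") (auto simp: le_max_iff_disj)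
  then show thesis by (intro that[of "max 0 C"]) auto
qed

lemma integral_lborel_translate:
  fixes f :: "'a::euclidean_space \<Rightarrow> real"
  assumes "f \<in> borel_measurable borel"
  shows "(\<integral>x. f (c + x) \<partial>lborel) = integral\<^sup>L lborel f"
proof -
  have "integral\<^sup>L (distr lborel borel ((+) c)) f = (\<integral>x. f (c + x) \<partial>lborel)"
    using assms by (intro integral_distr) auto
  then show ?thesis by (simp add: lborel_distr_plus)
qed

text \<open>The integrals of the difference quotients vanish by translation invariance.\<close>
lemma integral_frechet_derivative_test_function:
  assumes \<phi>: "\<phi> \<in> test_functions \<Omega>" and b: "b \<in> Basis"
  shows "(\<integral>x. frechet_derivative \<phi> (at x) b \<partial>lborel) = 0"
proof -
  obtain K where K: "compact K" "\<And>x. x \<notin> K \<Longrightarrow> \<phi> x = 0"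
    using \<phi> by (rule test_functions_support) blast
  have cont: "continuous_on UNIV \<phi>"
    using test_functions_smooth[OF \<phi>, of 0] by simp
  then have meas: "\<phi> \<in> borel_measurable borel" by (rule borel_measurable_continuous_onI)
  have int: "integrable lborel \<phi>" using integrable_compact_support[OF cont K] .
  have smooth: "continuously_differentiable (Suc 0) \<phi>" by (rule test_functions_smooth[OF \<phi>])
  have D: "(\<phi> has_derivative (\<lambda>h. gradient \<phi> x \<bullet> h)) (at x)" for x
    using has_derivative_gradient smooth_differentiable[OF smooth] .
  obtain C where C: "C \<ge> 0" "\<And>x. norm (gradient \<phi> x) \<le> C"
    using compact_support_bounded[OF continuous_gradient[OF smooth] K(1)]
      gradient_eq_0_outside[OF compact_imp_closed[OF K(1)], of \<phi>] K(2) by metis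
  have Lip: "norm (\<phi> x - \<phi> y) \<le> C * norm (x - y)" for x y
  proof (rule differentiable_bound[of UNIV \<phi> "\<lambda>x h. gradient \<phi> x \<bullet> h"])
    show "onorm (\<lambda>h. gradient \<phi> x \<bullet> h) \<le> C" for x
    proof (rule onorm_bound[OF C(1)])
      fix h
      have "norm (gradient \<phi> x \<bullet> h) \<le> norm (gradient \<phi> x) * norm h"
        by (simp add: Cauchy_Schwarz_ineq2)
      also have "\<dots> \<le> C * norm h" using C by (intro mult_right_mono) auto
      finally show "norm (gradient \<phi> x \<bullet> h) \<le> C * norm h" .
    qed
  qed (use D in auto)
  \<comment> \<open>Steps of length at most 1 make all difference quotients vanish off one compact
    set, the \<open>L\<close> below; \<open>C\<close> times its indicator dominates them.\<close>
  define \<epsilon> where "\<epsilon> n = inverse (real (Suc n))" for n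
  have \<epsilon>: "\<epsilon> n > 0" "\<epsilon> n \<le> 1" for n by (auto simp: \<epsilon>_def field_simps)
  define q where "q n x = (\<phi> (\<epsilon> n *\<^sub>R b + x) - \<phi> x) / \<epsilon> n" for n x
  define L where "L = (\<lambda>(x, y). x - y) ` (K \<times> cball (0::'a) 1)"
  have L: "compact L"
    unfolding L_def using K(1)
    by (intro compact_continuous_image compact_Times) (auto intro!: continuous_intros simp: case_prod_unfold)
  have q_meas: "q n \<in> borel_measurable borel" for n
    unfolding q_def[abs_def]
    by (intro borel_measurable_continuous_onI continuous_intros
        continuous_on_compose2[OF cont] continuous_on_subset[OF cont]) (use \<epsilon>(1)[of n] in auto)
  have q_int: "integral\<^sup>L lborel (q n) = 0" for n
  proof -
    have "integrable lborel (\<lambda>x. \<phi> (\<epsilon> n *\<^sub>R b + x))"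
    proof -
      have "integrable (distr lborel borel ((+) (\<epsilon> n *\<^sub>R b))) \<phi>"
        using int by (simp add: lborel_distr_plus)
      then show ?thesis using meas by (subst (asm) integrable_distr_eq) auto
    qed
    then show ?thesis
      using int integral_lborel_translate[OF meas, of "\<epsilon> n *\<^sub>R b"] by (simp add: q_def[abs_def])
  qed
  have "(\<lambda>n. integral\<^sup>L lborel (q n)) \<longlonglongrightarrow> (\<integral>x. frechet_derivative \<phi> (at x) b \<partial>lborel)"
  proof (rule integral_dominated_convergence[where w = "\<lambda>x. C * indicator L x"])
    show "(\<lambda>x. frechet_derivative \<phi> (at x) b) \<in> borel_measurable lborel"
      using test_functions_smooth[OF test_functions_frechet_derivative[OF \<phi> b], of 0]
      by (simp add: borel_measurable_continuous_onI)
    show "q n \<in> borel_measurable lborel" for n using q_meas by simp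
    show "integrable lborel (\<lambda>x. C * indicator L x)"
      using L emeasure_compact_finite[of L] by (auto intro!: integrable_mult_right integrable_real_indicator borel_closed compact_imp_closed)
    show "AE x in lborel. (\<lambda>n. q n x) \<longlonglongrightarrow> frechet_derivative \<phi> (at x) b"
    proof (rule AE_I2)
      fix x
      have "((\<lambda>t. \<phi> (x + t *\<^sub>R b)) has_real_derivative (gradient \<phi> x \<bullet> b)) (at 0)"
      proof -
        have "((\<lambda>t. x + t *\<^sub>R b) has_derivative (\<lambda>t. t *\<^sub>R b)) (at 0)"
          by (auto intro!: derivative_eq_intros)
        from has_derivative_compose[OF this, of \<phi> "\<lambda>h. gradient \<phi> x \<bullet> h"] D[of x]
        show ?thesis by (simp add: has_field_derivative_def mult.commute[of _ "_ \<bullet> _"])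
      qed
      then have "((\<lambda>t. (\<phi> (x + t *\<^sub>R b) - \<phi> x) / t) \<longlongrightarrow> gradient \<phi> x \<bullet> b) (at 0)"
        by (simp add: has_field_derivative_iff)
      moreover have "filterlim \<epsilon> (at 0) sequentially"
        unfolding filterlim_at using LIMSEQ_inverse_real_of_nat \<epsilon>(1)
        by (auto simp: \<epsilon>_def[abs_def])
      ultimately have "(\<lambda>n. (\<phi> (x + \<epsilon> n *\<^sub>R b) - \<phi> x) / \<epsilon> n) \<longlonglongrightarrow> gradient \<phi> x \<bullet> b"
        by (rule filterlim_compose)
      then show "(\<lambda>n. q n x) \<longlonglongrightarrow> frechet_derivative \<phi> (at x) b"
        by (simp add: q_def add.commute gradient_inner_Basis[OF b])
    qed
    show "AE x in lborel. norm (q n x) \<le> C * indicator L x" for n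
    proof (rule AE_I2)
      fix x
      show "norm (q n x) \<le> C * indicator L x"
      proof (cases "x \<in> L")
        case True
        have "norm (\<phi> (\<epsilon> n *\<^sub>R b + x) - \<phi> x) \<le> C * \<epsilon> n"
          using Lip[of "\<epsilon> n *\<^sub>R b + x" x] \<epsilon>(1)[of n] b by simp
        then show ?thesis
          using True \<epsilon>(1)[of n] by (simp add: q_def field_simps)
      next
        case False
        have mem: "y - z \<in> L" if "y \<in> K" "norm z \<le> 1" for y z
          using that unfolding L_def by (force intro: image_eqI[of _ _ "(y, z)"])
        have "x \<notin> K" using mem[of x 0] False by auto
        moreover have "\<epsilon> n *\<^sub>R b + x \<notin> K"
          using mem[of "\<epsilon> n *\<^sub>R b + x" "\<epsilon> n *\<^sub>R b"] False \<epsilon>[of n] b by auto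
        ultimately show ?thesis using K(2) C(1) by (simp add: q_def)
      qed
    qed
  qed
  then show ?thesis
    by (simp add: q_int LIMSEQ_const_iff)
qed

subsection \<open>Weak gradients of test functions\<close>

text \<open>By the product rule the two integrands add up to a derivative of the test function
  \<open>\<phi> x * \<psi> x\<close>, whose integral vanishes.\<close>

lemma integral_by_parts_test_functions:
  assumes \<phi>: "\<phi> \<in> test_functions \<Omega>" and \<psi>: "\<psi> \<in> test_functions \<Omega>" and b: "b \<in> Basis"
  shows "(\<integral>x. \<phi> x * frechet_derivative \<psi> (at x) b \<partial>lborel) =
    - (\<integral>x. frechet_derivative \<phi> (at x) b * \<psi> x \<partial>lborel)"
proof -
  obtain K where K: "compact K" "\<And>x. x \<notin> K \<Longrightarrow> \<phi> x = 0"
    using \<phi> by (rule test_functions_support) blast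
  have smooth: "continuously_differentiable n \<phi>" "continuously_differentiable n \<psi>" for n
    using \<phi> \<psi> by (auto intro: test_functions_smooth)
  have cont: "continuous_on UNIV \<phi>" "continuous_on UNIV \<psi>"
      "continuous_on UNIV (\<lambda>x. frechet_derivative \<phi> (at x) b)"
      "continuous_on UNIV (\<lambda>x. frechet_derivative \<psi> (at x) b)"
    using smooth[of 0] smooth[of "Suc 0"] b by auto
  have int1: "integrable lborel (\<lambda>x. \<phi> x * frechet_derivative \<psi> (at x) b)"
    by (rule integrable_compact_support[OF _ K(1)]) (use K cont in \<open>auto intro: continuous_intros\<close>)
  have int2: "integrable lborel (\<lambda>x. frechet_derivative \<phi> (at x) b * \<psi> x)"
    by (rule integrable_compact_support[OF _ K(1)])
       (use K cont in \<open>auto intro: continuous_intros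
          simp: frechet_derivative_eq_0_outside[OF compact_imp_closed[OF K(1)] K(2) _ b]\<close>)
  have "frechet_derivative (\<lambda>x. \<phi> x * \<psi> x) (at x) b =
      \<phi> x * frechet_derivative \<psi> (at x) b + frechet_derivative \<phi> (at x) b * \<psi> x" for x
    using frechet_derivative_at[OF has_derivative_mult[OF
        smooth[of "Suc 0", THEN continuously_differentiable_Suc_has_derivative]], of x]
    by metis
  then have "(\<integral>x. \<phi> x * frechet_derivative \<psi> (at x) b \<partial>lborel) +
      (\<integral>x. frechet_derivative \<phi> (at x) b * \<psi> x \<partial>lborel) = 0"
    using integral_frechet_derivative_test_function[OF test_functions_mult[OF \<phi> smooth(2)] b]
    by (simp add: Bochner_Integration.integral_add[OF int1 int2])
  then show ?thesis by simp
qed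

lemma test_functions_measurable:
  assumes "\<phi> \<in> test_functions \<Omega>"
  shows "\<phi> \<in> borel_measurable borel" "gradient \<phi> \<in> borel_measurable borel"
  using test_functions_smooth[OF assms, of 0]
    continuous_gradient[OF test_functions_smooth[OF assms], of UNIV]
  by (auto intro: borel_measurable_continuous_onI)

lemma gradient_test_function_eq_0:
  assumes "\<phi> \<in> test_functions \<Omega>" "x \<notin> \<Omega>"
  shows "gradient \<phi> x = 0"
proof -
  obtain K where K: "compact K" "K \<subseteq> \<Omega>" "\<And>x. x \<notin> K \<Longrightarrow> \<phi> x = 0"
    using assms(1) by (rule test_functions_support) blast
  with assms(2) show ?thesis
    by (intro gradient_eq_0_outside[of K]) (auto simp: compact_imp_closed)
qed

lemma test_function_eq_0: "\<phi> \<in> test_functions \<Omega> \<Longrightarrow> x \<notin> \<Omega> \<Longrightarrow> \<phi> x = 0"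
  by (erule test_functions_support) blast

lemma integrable_test_function_powr:
  assumes "\<phi> \<in> test_functions \<Omega>" "p > 0"
  shows "integrable lborel (\<lambda>x. \<bar>\<phi> x\<bar> powr p)"
    and "integrable lborel (\<lambda>x. norm (gradient \<phi> x) powr p)"
proof -
  obtain K where K: "compact K" "K \<subseteq> \<Omega>" "\<And>x. x \<notin> K \<Longrightarrow> \<phi> x = 0"
    using assms(1) by (rule test_functions_support) blast
  have "continuous_on UNIV \<phi>"
    using test_functions_smooth[OF assms(1), of 0] by simp
  with K assms(2) show "integrable lborel (\<lambda>x. \<bar>\<phi> x\<bar> powr p)"
    by (intro integrable_compact_support[of _ K] continuous_on_powr') (auto intro!: continuous_intros)
  have "continuous_on UNIV (gradient \<phi>)"
    by (rule continuous_gradient[OF test_functions_smooth[OF assms(1)]])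
  moreover have "gradient \<phi> x = 0" if "x \<notin> K" for x
    using K that by (intro gradient_eq_0_outside[of K]) (auto simp: compact_imp_closed)
  ultimately show "integrable lborel (\<lambda>x. norm (gradient \<phi> x) powr p)"
    using K(1) assms(2)
    by (intro integrable_compact_support[of _ K] continuous_on_powr') (auto intro!: continuous_intros)
qed

text \<open>With \<open>(1 + \<tau>) powr p = 1 + \<eta>\<close>, either \<open>b\<close> is at most
  \<open>\<tau> * a\<close> and is absorbed into the first term, or \<open>a\<close> is below
  \<open>b / \<tau>\<close> and the second term takes all. The factor of \<open>a powr p\<close>
  comes as close to 1 as desired, which is what makes the error vanish in the limit.\<close>

lemma powr_add_le:
  fixes p :: real
  assumes "p > 0" "\<eta> > 0"
  obtains C where "C \<ge> 0"
    "\<And>a b. a \<ge> 0 \<Longrightarrow> b \<ge> 0 \<Longrightarrow> (a + b) powr p \<le> (1 + \<eta>) * a powr p + C * b powr p"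
proof -
  define \<tau> where "\<tau> = (1 + \<eta>) powr (1 / p) - 1"
  have \<tau>: "\<tau> > 0" using assms by (simp add: \<tau>_def)
  have \<tau>p: "(1 + \<tau>) powr p = 1 + \<eta>" using assms by (simp add: \<tau>_def powr_powr)
  show thesis
  proof (rule that[of "(1 / \<tau> + 1) powr p"])
    fix a b :: real assume ab: "a \<ge> 0" "b \<ge> 0"
    show "(a + b) powr p \<le> (1 + \<eta>) * a powr p + (1 / \<tau> + 1) powr p * b powr p"
    proof (cases "b \<le> \<tau> * a")
      case True
      then have "(a + b) powr p \<le> ((1 + \<tau>) * a) powr p"
        using ab assms by (intro powr_mono2) (auto simp: algebra_simps)
      also have "\<dots> = (1 + \<eta>) * a powr p" using \<tau> ab by (simp add: powr_mult \<tau>p)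
      finally show ?thesis by (simp add: add_increasing2)
    next
      case False
      then have "(a + b) powr p \<le> ((1 / \<tau> + 1) * b) powr p"
        using ab assms \<tau> by (intro powr_mono2) (auto simp: field_simps)
      also have "\<dots> = (1 / \<tau> + 1) powr p * b powr p" using \<tau> ab by (simp add: powr_mult)
      finally show ?thesis using assms by (simp add: add_increasing)
    qed
  qed simp
qed

lemma Lp_diff:
  assumes "p > 0" "f \<in> Lp p \<Omega>" "g \<in> Lp p \<Omega>"
  shows "(\<lambda>x. f x - g x) \<in> Lp p \<Omega>"
proof -
  have [measurable]: "f \<in> borel_measurable (lebesgue_on \<Omega>)" "g \<in> borel_measurable (lebesgue_on \<Omega>)"
    using assms by (auto simp: Lp_def)
  obtain C where C: "C \<ge> 0"
      "\<And>a b. a \<ge> 0 \<Longrightarrow> b \<ge> 0 \<Longrightarrow> (a + b) powr p \<le> (1 + 1) * a powr p + C * b powr p"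
    using powr_add_le[OF assms(1), of 1] by auto
  have "integrable (lebesgue_on \<Omega>) (\<lambda>x. 2 * norm (f x) powr p + C * norm (g x) powr p)"
    using assms by (auto simp: Lp_def)
  then have "integrable (lebesgue_on \<Omega>) (\<lambda>x. norm (f x - g x) powr p)"
  proof (rule Bochner_Integration.integrable_bound)
    show "AE x in lebesgue_on \<Omega>. norm (norm (f x - g x) powr p) \<le>
        norm (2 * norm (f x) powr p + C * norm (g x) powr p)"
    proof (rule AE_I2)
      fix x
      have "norm (f x - g x) powr p \<le> (norm (f x) + norm (g x)) powr p"
        using assms(1) by (intro powr_mono2 norm_triangle_ineq4) auto
      also have "\<dots> \<le> 2 * norm (f x) powr p + C * norm (g x) powr p"
        using C(2)[of "norm (f x)" "norm (g x)"] by simp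
      finally show "norm (norm (f x - g x) powr p) \<le>
          norm (2 * norm (f x) powr p + C * norm (g x) powr p)" by simp
    qed
  qed measurable
  then show ?thesis by (simp add: Lp_def)
qed

text \<open>A bounded set has finite measure and \<open>t \<le> 1 + t powr p\<close>. Integrability
  is needed before the defining identities of two weak gradients can be subtracted, since a
  non-integrable function has integral 0 by convention.\<close>

lemma Lp_integrable:
  assumes "p \<ge> 1" "open \<Omega>" "bounded \<Omega>" "f \<in> Lp p \<Omega>"
  shows "integrable (lebesgue_on \<Omega>) f"
proof -
  have "finite_measure (lebesgue_on \<Omega>)"
    using assms by (intro finite_measure_lebesgue_on) (simp add: bounded_set_imp_lmeasurable)
  then have "integrable (lebesgue_on \<Omega>) (\<lambda>x. 1 + norm (f x) powr p)"
    using assms(4) by (auto simp: Lp_def finite_measure.integrable_const)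
  then show ?thesis
  proof (rule Bochner_Integration.integrable_bound)
    have "t \<le> 1 + t powr p" if "t \<ge> 0" for t :: real
    proof (cases "t \<le> 1")
      case False
      then have "t powr 1 \<le> t powr p" using assms(1) by (intro powr_mono) auto
      with False show ?thesis by simp
    qed (simp add: add_increasing2)
    then show "AE x in lebesgue_on \<Omega>. norm (f x) \<le> norm (1 + norm (f x) powr p)"
      by (auto simp: add_nonneg_nonneg)
  qed (use assms(4) in \<open>simp add: Lp_def\<close>)
qed

lemma integrable_mult_test_function:
  assumes "open \<Omega>" and f: "integrable (lebesgue_on \<Omega>) f" and \<phi>: "\<phi> \<in> test_functions \<Omega>'"
  shows "integrable (lebesgue_on \<Omega>) (\<lambda>x. f x * \<phi> x :: real)"
proof -
  obtain K where K: "compact K" "K \<subseteq> \<Omega>'" "\<And>x. x \<notin> K \<Longrightarrow> \<phi> x = 0"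
    using \<phi> by (rule test_functions_support) blast
  have cont: "continuous_on UNIV \<phi>"
    using test_functions_smooth[OF \<phi>, of 0] by simp
  obtain C where C: "\<And>x. norm (\<phi> x) \<le> C"
    using compact_support_bounded[OF cont K(1,3)] by blast
  have "\<phi> \<in> borel_measurable (lebesgue_on \<Omega>)"
    using test_functions_measurable(1)[OF \<phi>]
    by (intro measurable_restrict_space1) (simp add: measurable_completion)
  with f have "(\<lambda>x. f x * \<phi> x) \<in> borel_measurable (lebesgue_on \<Omega>)" by auto
  moreover have "integrable (lebesgue_on \<Omega>) (\<lambda>x. C * f x)" using f by simp
  moreover have "norm (f x * \<phi> x) \<le> norm (C * f x)" for x
    using mult_left_mono[of "\<bar>\<phi> x\<bar>" "\<bar>C\<bar>" "\<bar>f x\<bar>"] C[of x] by (simp add: abs_mult mult.commute)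
  then have "AE x in lebesgue_on \<Omega>. norm (f x * \<phi> x) \<le> norm (C * f x)" by simp
  ultimately show ?thesis
    using Bochner_Integration.integrable_bound by blast
qed

section \<open>Energies and approximation on a bounded open set\<close>

context
  fixes \<Omega> :: "'a::euclidean_space set" and p :: real
  assumes \<Omega>: "open \<Omega>" "bounded \<Omega>" and p: "p > 1"
begin

text \<open>Each coordinate of the difference of the two gradients integrates to 0 against every
  test function, so the fundamental lemma applies.\<close>

lemma weak_gradient_unique:
  assumes g: "is_weak_gradient p \<Omega> u g" and h: "is_weak_gradient p \<Omega> u h"
  shows "AE x in lebesgue_on \<Omega>. g x = h x"
proof -
  have int: "integrable (lebesgue_on \<Omega>) g" "integrable (lebesgue_on \<Omega>) h"
    using g h p by (auto simp: is_weak_gradient_def intro: Lp_integrable[OF _ \<Omega>, of p])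
  have ae: "AE x in lebesgue_on \<Omega>. (g x - h x) \<bullet> b = 0" if b: "b \<in> Basis" for b
  proof (rule AE_zero_if_integral_zero_test_functions[OF \<Omega>(1)])
    have intb: "integrable (lebesgue_on \<Omega>) (\<lambda>x. g x \<bullet> b)" "integrable (lebesgue_on \<Omega>) (\<lambda>x. h x \<bullet> b)"
      using int by auto
    then show "integrable (lebesgue_on \<Omega>) (\<lambda>x. (g x - h x) \<bullet> b)"
      by (simp add: inner_diff_left)
    fix \<phi> assume \<phi>: "\<phi> \<in> test_functions \<Omega>"
    have "(\<integral>x. u x * frechet_derivative \<phi> (at x) b \<partial>lebesgue_on \<Omega>) =
          - (\<integral>x. (g x \<bullet> b) * \<phi> x \<partial>lebesgue_on \<Omega>)"
      and "(\<integral>x. u x * frechet_derivative \<phi> (at x) b \<partial>lebesgue_on \<Omega>) =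
          - (\<integral>x. (h x \<bullet> b) * \<phi> x \<partial>lebesgue_on \<Omega>)"
      using g h b \<phi> unfolding is_weak_gradient_def by blast+
    then have "(\<integral>x. (g x \<bullet> b) * \<phi> x \<partial>lebesgue_on \<Omega>) = (\<integral>x. (h x \<bullet> b) * \<phi> x \<partial>lebesgue_on \<Omega>)"
      by linarith
    then show "(\<integral>x. (g x - h x) \<bullet> b * \<phi> x \<partial>lebesgue_on \<Omega>) = 0"
      using intb[THEN integrable_mult_test_function[OF \<Omega>(1) _ \<phi>]]
      by (simp add: inner_diff_left left_diff_distrib)
  qed
  have "AE x in lebesgue_on \<Omega>. \<forall>b\<in>Basis. (g x - h x) \<bullet> b = 0"
    by (rule AE_finite_allI) (auto intro: ae)
  then show ?thesis
  proof eventually_elim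
    case (elim x)
    show ?case
      by (rule euclidean_eqI) (use elim in \<open>simp add: inner_diff_left\<close>)
  qed
qed

text \<open>\<open>weak_gradient\<close> is a choice; uniqueness almost everywhere lets the energy
  be computed from any weak gradient at hand.\<close>

lemma dirichlet_energy_eq:
  assumes g: "is_weak_gradient p \<Omega> u g"
  shows "dirichlet_energy p \<Omega> u = (\<integral>x. norm (g x) powr p \<partial>lebesgue_on \<Omega>)"
proof -
  have W: "is_weak_gradient p \<Omega> u (weak_gradient p \<Omega> u)"
    unfolding weak_gradient_def[abs_def] using someI[of "is_weak_gradient p \<Omega> u", OF g] .
  have meas: "(\<lambda>x. norm (g x) powr p) \<in> borel_measurable (lebesgue_on \<Omega>)"
    if "is_weak_gradient p \<Omega> u g" for g
    using that by (auto simp: is_weak_gradient_def Lp_def)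
  from weak_gradient_unique[OF W g]
  have "AE x in lebesgue_on \<Omega>. norm (weak_gradient p \<Omega> u x) powr p = norm (g x) powr p"
    by eventually_elim simp
  then show ?thesis
    unfolding dirichlet_energy_def by (intro integral_cong_AE meas W g)
qed

lemma is_weak_gradient_diff:
  assumes "is_weak_gradient p \<Omega> u g" "is_weak_gradient p \<Omega> v h"
  shows "is_weak_gradient p \<Omega> (\<lambda>x. u x - v x) (\<lambda>x. g x - h x)"
  unfolding is_weak_gradient_def
proof (intro conjI ballI)
  have Lp: "u \<in> Lp p \<Omega>" "v \<in> Lp p \<Omega>" "g \<in> Lp p \<Omega>" "h \<in> Lp p \<Omega>"
    using assms by (auto simp: is_weak_gradient_def)
  then show "(\<lambda>x. u x - v x) \<in> Lp p \<Omega>" "(\<lambda>x. g x - h x) \<in> Lp p \<Omega>"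
    using p by (auto intro: Lp_diff)
  have int: "integrable (lebesgue_on \<Omega>) u" "integrable (lebesgue_on \<Omega>) v"
      "integrable (lebesgue_on \<Omega>) g" "integrable (lebesgue_on \<Omega>) h"
    using Lp p by (simp_all add: Lp_integrable[OF _ \<Omega>, of p])
  fix \<phi> and b :: 'a assume \<phi>: "\<phi> \<in> test_functions \<Omega>" and b: "b \<in> Basis"
  note mult = integrable_mult_test_function[OF \<Omega>(1)]
  have "integrable (lebesgue_on \<Omega>) (\<lambda>x. g x \<bullet> b)" "integrable (lebesgue_on \<Omega>) (\<lambda>x. h x \<bullet> b)"
    using int by auto
  then have *: "integrable (lebesgue_on \<Omega>) (\<lambda>x. (g x \<bullet> b) * \<phi> x)"
      "integrable (lebesgue_on \<Omega>) (\<lambda>x. (h x \<bullet> b) * \<phi> x)"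
    using mult[OF _ \<phi>] by auto
  have **: "integrable (lebesgue_on \<Omega>) (\<lambda>x. u x * frechet_derivative \<phi> (at x) b)"
      "integrable (lebesgue_on \<Omega>) (\<lambda>x. v x * frechet_derivative \<phi> (at x) b)"
    using mult[OF _ test_functions_frechet_derivative[OF \<phi> b]] int by auto
  show "(\<integral>x. (u x - v x) * frechet_derivative \<phi> (at x) b \<partial>lebesgue_on \<Omega>) =
      - (\<integral>x. (g x - h x) \<bullet> b * \<phi> x \<partial>lebesgue_on \<Omega>)"
    using assms \<phi> b * **
    by (simp add: inner_diff_left left_diff_distrib is_weak_gradient_def)
qed

lemma is_weak_gradient_test_function:
  assumes \<phi>: "\<phi> \<in> test_functions \<Omega>"
  shows "is_weak_gradient p \<Omega> \<phi> (gradient \<phi>)"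
  unfolding is_weak_gradient_def
proof (intro conjI ballI)
  note meas = test_functions_measurable[OF \<phi>]
  have meas': "\<phi> \<in> borel_measurable (lebesgue_on \<Omega>)" "gradient \<phi> \<in> borel_measurable (lebesgue_on \<Omega>)"
    using meas by (auto intro!: measurable_restrict_space1 simp: measurable_completion)
  note int = integrable_test_function_powr[OF \<phi>, of p]
  have "integrable (lebesgue_on \<Omega>) (\<lambda>x. \<bar>\<phi> x\<bar> powr p)"
    using int(1) p meas test_function_eq_0[OF \<phi>]
    by (subst integrable_lebesgue_on_support[OF \<Omega>(1)]) auto
  with meas' show "\<phi> \<in> Lp p \<Omega>" by (simp add: Lp_def)
  have "integrable (lebesgue_on \<Omega>) (\<lambda>x. norm (gradient \<phi> x) powr p)"
    using int(2) p meas gradient_test_function_eq_0[OF \<phi>]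
    by (subst integrable_lebesgue_on_support[OF \<Omega>(1)]) auto
  with meas' show "gradient \<phi> \<in> Lp p \<Omega>" by (simp add: Lp_def)
  fix \<psi> and b :: 'a assume \<psi>: "\<psi> \<in> test_functions \<Omega>" and b: "b \<in> Basis"
  note \<psi>' = test_functions_frechet_derivative[OF \<psi> b]
  note [measurable] = test_functions_measurable(1)[OF \<phi>] test_functions_measurable(1)[OF \<psi>]
    test_functions_measurable(1)[OF \<psi>']
    test_functions_measurable(1)[OF test_functions_frechet_derivative[OF \<phi> b]]
  have "(\<integral>x. \<phi> x * frechet_derivative \<psi> (at x) b \<partial>lebesgue_on \<Omega>) =
      (\<integral>x. \<phi> x * frechet_derivative \<psi> (at x) b \<partial>lborel)"
    by (rule integral_lebesgue_on_support[OF \<Omega>(1)]) (auto simp: test_function_eq_0[OF \<phi>])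
  moreover have "(\<integral>x. gradient \<phi> x \<bullet> b * \<psi> x \<partial>lebesgue_on \<Omega>) =
      (\<integral>x. frechet_derivative \<phi> (at x) b * \<psi> x \<partial>lborel)"
    unfolding gradient_inner_Basis[OF b]
    by (rule integral_lebesgue_on_support[OF \<Omega>(1)]) (auto simp: test_function_eq_0[OF \<psi>])
  ultimately show "(\<integral>x. \<phi> x * frechet_derivative \<psi> (at x) b \<partial>lebesgue_on \<Omega>) =
      - (\<integral>x. gradient \<phi> x \<bullet> b * \<psi> x \<partial>lebesgue_on \<Omega>)"
    using integral_by_parts_test_functions[OF \<phi> \<psi> b] by simp
qed

lemma dirichlet_energy_test_function:
  assumes \<phi>: "\<phi> \<in> test_functions \<Omega>"
  shows "dirichlet_energy p \<Omega> \<phi> = (\<integral>x. norm (gradient \<phi> x) powr p \<partial>lborel)"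
  unfolding dirichlet_energy_eq[OF is_weak_gradient_test_function[OF \<phi>]]
  using test_functions_measurable(2)[OF \<phi>] gradient_test_function_eq_0[OF \<phi>]
  by (intro integral_lebesgue_on_support \<Omega>(1)) auto

lemma Lp_integral_test_function:
  assumes \<phi>: "\<phi> \<in> test_functions \<Omega>"
  shows "Lp_integral p \<Omega> \<phi> = (\<integral>x. \<bar>\<phi> x\<bar> powr p \<partial>lborel)"
  unfolding Lp_integral_def
  using test_functions_measurable(1)[OF \<phi>] test_function_eq_0[OF \<phi>]
  by (intro integral_lebesgue_on_support \<Omega>(1)) auto

lemma test_functions_W0p:
  assumes \<phi>: "\<phi> \<in> test_functions \<Omega>"
  shows "\<phi> \<in> W0p p \<Omega>"
proof -
  \<comment> \<open>The approximant of \<open>\<phi>\<close> is \<open>\<phi>\<close> itself. That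
    the zero function has energy 0 still requires an argument, since its weak gradient is chosen;
    the formula for test functions supplies it.\<close>
  have zero: "(\<lambda>x. 0) \<in> test_functions \<Omega>"
    using test_functions_cmult[OF \<phi>, of 0] by simp
  have "gradient (\<lambda>x. 0 :: real) y = 0" for y :: 'a
    by (rule gradient_eqI) simp
  then have "W1p_norm p \<Omega> (\<lambda>x. \<phi> x - \<phi> x) = 0"
    using p by (simp add: W1p_norm_def dirichlet_energy_test_function[OF zero] Lp_integral_def)
  then have "\<exists>\<psi>\<in>test_functions \<Omega>. W1p_norm p \<Omega> (\<lambda>x. \<phi> x - \<psi> x) < e" if "e > 0" for e
    using that by (intro bexI[OF _ \<phi>]) simp
  then show ?thesis
    using is_weak_gradient_test_function[OF \<phi>] unfolding W0p_def W1p_def by blast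
qed

text \<open>The triangle inequality of \<open>L\<^sup>p\<close> is replaced by the elementary bound
  \<open>(a + b)\<^sup>p \<le> (1 + \<eta>) a\<^sup>p + C\<^sub>\<eta> b\<^sup>p\<close>.\<close>
lemma Lp_sphere_approx:
  assumes u: "u \<in> Lp_sphere p \<Omega>" and d: "d > 0"
  obtains \<phi> where "\<phi> \<in> test_functions \<Omega>" "(\<integral>x. \<bar>\<phi> x\<bar> powr p \<partial>lborel) \<ge> 1 - d"
    "(\<integral>x. norm (gradient \<phi> x) powr p \<partial>lborel) \<le> dirichlet_energy p \<Omega> u + d"
proof -
  let ?M = "lebesgue_on \<Omega>"
  obtain g where g: "is_weak_gradient p \<Omega> u g"
    using u by (auto simp: Lp_sphere_def W0p_def W1p_def)
  have E: "dirichlet_energy p \<Omega> u = (\<integral>x. norm (g x) powr p \<partial>?M)"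
    by (rule dirichlet_energy_eq[OF g])
  have E0: "dirichlet_energy p \<Omega> u \<ge> 0" by (simp add: dirichlet_energy_def)
  have u1: "(\<integral>x. \<bar>u x\<bar> powr p \<partial>?M) = 1"
    using u by (simp add: Lp_sphere_def Lp_integral_def)
  \<comment> \<open>The error budget \<open>d\<close> is split in halves. The two bounds make
    \<open>\<eta>\<close> cost at most \<open>d / 2\<close> in the mass and in the energy of
    \<open>u\<close>; adding 1 keeps the denominator positive.\<close>
  define \<eta> where "\<eta> = min (d / 2) (d / (2 * (dirichlet_energy p \<Omega> u + 1)))"
  have \<eta>: "\<eta> > 0" using d E0 by (simp add: \<eta>_def)
  obtain C where C: "C \<ge> 0"
      "\<And>a b. a \<ge> 0 \<Longrightarrow> b \<ge> 0 \<Longrightarrow> (a + b) powr p \<le> (1 + \<eta>) * a powr p + C * b powr p"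
    using powr_add_le[of p \<eta>] \<eta> p by auto
  \<comment> \<open>Approximation within \<open>e\<close> costs at most
    \<open>C * e powr p \<le> d / 2\<close>, the other half of the budget.\<close>
  define e where "e = (d / (2 * (C + 1))) powr (1 / p)"
  have e: "e > 0" "e powr p = d / (2 * (C + 1))"
    using d C p by (auto simp: e_def powr_powr)
  have Ce: "C * (d / (2 * (C + 1))) \<le> d / 2"
    using C d by (simp add: field_simps)
  obtain \<phi> where \<phi>: "\<phi> \<in> test_functions \<Omega>" "W1p_norm p \<Omega> (\<lambda>x. u x - \<phi> x) < e"
    using u e by (auto simp: Lp_sphere_def W0p_def)
  note g\<phi> = is_weak_gradient_test_function[OF \<phi>(1)]
  note gd = is_weak_gradient_diff[OF g g\<phi>]
  define A where "A = (\<integral>x. \<bar>u x - \<phi> x\<bar> powr p \<partial>?M)"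
  define B where "B = (\<integral>x. norm (g x - gradient \<phi> x) powr p \<partial>?M)"
  have AB: "A \<ge> 0" "B \<ge> 0" by (simp_all add: A_def B_def)
  have "W1p_norm p \<Omega> (\<lambda>x. u x - \<phi> x) = (A + B) powr (1 / p)"
    by (simp add: W1p_norm_def Lp_integral_def A_def B_def dirichlet_energy_eq[OF gd])
  with \<phi>(2) have "((A + B) powr (1 / p)) powr p < e powr p"
    using p by (intro powr_less_mono2) auto
  then have "A + B < d / (2 * (C + 1))"
    using AB p e by (simp add: powr_powr)
  with AB have "A \<le> d / (2 * (C + 1))" "B \<le> d / (2 * (C + 1))" by auto
  then have "C * A \<le> C * (d / (2 * (C + 1)))" "C * B \<le> C * (d / (2 * (C + 1)))"
    using mult_left_mono[OF _ C(1)] by blast+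
  then have CAB: "C * A \<le> d / 2" "C * B \<le> d / 2"
    using Ce order_trans by blast+
  have int: "integrable ?M (\<lambda>x. \<bar>\<phi> x\<bar> powr p)" "integrable ?M (\<lambda>x. norm (gradient \<phi> x) powr p)"
      "integrable ?M (\<lambda>x. \<bar>u x\<bar> powr p)" "integrable ?M (\<lambda>x. norm (g x) powr p)"
      "integrable ?M (\<lambda>x. \<bar>u x - \<phi> x\<bar> powr p)" "integrable ?M (\<lambda>x. norm (g x - gradient \<phi> x) powr p)"
    using g g\<phi> gd by (auto simp: is_weak_gradient_def Lp_def)
  have "1 = (\<integral>x. \<bar>u x\<bar> powr p \<partial>?M)" by (simp add: u1)
  also have "\<dots> \<le> (\<integral>x. (1 + \<eta>) * \<bar>\<phi> x\<bar> powr p + C * \<bar>u x - \<phi> x\<bar> powr p \<partial>?M)"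
  proof (rule integral_mono)
    fix x
    have "\<bar>u x\<bar> powr p \<le> (\<bar>\<phi> x\<bar> + \<bar>u x - \<phi> x\<bar>) powr p"
      using p by (intro powr_mono2) auto
    also have "\<dots> \<le> (1 + \<eta>) * \<bar>\<phi> x\<bar> powr p + C * \<bar>u x - \<phi> x\<bar> powr p" by (intro C) auto
    finally show "\<bar>u x\<bar> powr p \<le> (1 + \<eta>) * \<bar>\<phi> x\<bar> powr p + C * \<bar>u x - \<phi> x\<bar> powr p" .
  qed (use int in auto)
  also have "\<dots> = (1 + \<eta>) * (\<integral>x. \<bar>\<phi> x\<bar> powr p \<partial>?M) + C * A"
    using int by (simp add: A_def)
  finally have 1: "1 \<le> (1 + \<eta>) * (\<integral>x. \<bar>\<phi> x\<bar> powr p \<partial>?M) + d / 2" using CAB by linarith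
  have "(\<integral>x. norm (gradient \<phi> x) powr p \<partial>?M) \<le>
      (\<integral>x. (1 + \<eta>) * norm (g x) powr p + C * norm (g x - gradient \<phi> x) powr p \<partial>?M)"
  proof (rule integral_mono)
    fix x
    have "norm (gradient \<phi> x) powr p \<le> (norm (g x) + norm (g x - gradient \<phi> x)) powr p"
      using p norm_triangle_sub[of "gradient \<phi> x" "g x"]
      by (intro powr_mono2) (auto simp: norm_minus_commute)
    also have "\<dots> \<le> (1 + \<eta>) * norm (g x) powr p + C * norm (g x - gradient \<phi> x) powr p"
      by (intro C) auto
    finally show "norm (gradient \<phi> x) powr p \<le>
        (1 + \<eta>) * norm (g x) powr p + C * norm (g x - gradient \<phi> x) powr p" .
  qed (use int in auto)
  also have "\<dots> = (1 + \<eta>) * dirichlet_energy p \<Omega> u + C * B"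
    using int by (simp add: B_def E)
  also have "\<dots> \<le> dirichlet_energy p \<Omega> u + d"
  proof -
    have "\<eta> * dirichlet_energy p \<Omega> u \<le> d / (2 * (dirichlet_energy p \<Omega> u + 1)) * dirichlet_energy p \<Omega> u"
      using E0 by (intro mult_right_mono) (auto simp: \<eta>_def)
    also have "\<dots> \<le> d / 2" using E0 d by (simp add: field_simps)
    finally show ?thesis using CAB by (simp add: algebra_simps)
  qed
  finally have 2: "(\<integral>x. norm (gradient \<phi> x) powr p \<partial>?M) \<le> dirichlet_energy p \<Omega> u + d" .
  show thesis
  proof (rule that[OF \<phi>(1)])
    let ?I = "\<integral>x. \<bar>\<phi> x\<bar> powr p \<partial>lborel"
    have eq: "?I = (\<integral>x. \<bar>\<phi> x\<bar> powr p \<partial>?M)"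
      using Lp_integral_test_function[OF \<phi>(1)] by (simp add: Lp_integral_def)
    have "?I \<ge> 0" by simp
    \<comment> \<open>If the mass is below 1, then \<open>\<eta>\<close> times it is at most
      \<open>\<eta> \<le> d / 2\<close>; a mass of at least 1 is already enough.\<close>
    show "?I \<ge> 1 - d"
    proof (cases "?I \<ge> 1")
      case False
      then have "\<eta> * ?I \<le> \<eta> * 1" using \<eta> by (intro mult_left_mono) auto
      moreover have "\<eta> \<le> d / 2" unfolding \<eta>_def by (rule min.cobounded1)
      ultimately show ?thesis using 1 unfolding eq[symmetric] by (simp add: algebra_simps)
    qed (use d in simp)
    show "(\<integral>x. norm (gradient \<phi> x) powr p \<partial>lborel) \<le> dirichlet_energy p \<Omega> u + d"
      using 2 dirichlet_energy_eq[OF g\<phi>] dirichlet_energy_test_function[OF \<phi>(1)] by simp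
  qed
qed

end

subsection \<open>Power means and hidden convexity\<close>

text \<open>Jensen's inequality from the tangent to \<open>t powr p\<close> at the weighted mean
  \<open>m\<close>. The endpoint 0, where the tangent has the value
  \<open>(1 - p) * m powr p\<close>, is included by hand, because gradients may vanish in the
  application.\<close>

lemma powr_convex_nonneg:
  fixes \<theta> y :: "'i \<Rightarrow> real"
  assumes p: "p \<ge> 1" and I: "finite I" and \<theta>: "\<And>i. i \<in> I \<Longrightarrow> \<theta> i \<ge> 0" "(\<Sum>i\<in>I. \<theta> i) = 1"
    and y: "\<And>i. i \<in> I \<Longrightarrow> y i \<ge> 0"
  shows "(\<Sum>i\<in>I. \<theta> i * y i) powr p \<le> (\<Sum>i\<in>I. \<theta> i * y i powr p)"
proof -
  define m where "m = (\<Sum>i\<in>I. \<theta> i * y i)"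
  have m0: "m \<ge> 0" unfolding m_def using \<theta> y by (intro sum_nonneg) auto
  show ?thesis
  proof (cases "m = 0")
    case True
    then show ?thesis
      using \<theta> by (simp add: m_def[symmetric] sum_nonneg)
  next
    case False
    with m0 have m: "m > 0" by simp
    have tangent: "m powr p + p * m powr (p - 1) * (t - m) \<le> t powr p" if "t \<ge> 0" for t
    proof (cases "t = 0")
      case True
      have "m powr p = m powr (p - 1) * m" using m by (simp add: powr_diff)
      moreover have "1 * (m powr (p - 1) * m) \<le> p * (m powr (p - 1) * m)"
        using p m by (intro mult_right_mono) auto
      ultimately show ?thesis using True by simp
    next
      case False
      have "t powr p - m powr p \<ge> (p * m powr (p - 1)) * (t - m)"
        by (rule convex_on_imp_above_tangent[OF powr_convex[OF p]])
           (use m that False in \<open>auto intro!: has_field_derivative_at_within has_real_derivative_powr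
              simp: interior_open\<close>)
      then show ?thesis by simp
    qed
    have "m powr p = (\<Sum>i\<in>I. \<theta> i) * m powr p + p * m powr (p - 1) * (m - (\<Sum>i\<in>I. \<theta> i) * m)"
      by (simp add: \<theta>)
    also have "\<dots> = (\<Sum>i\<in>I. \<theta> i * (m powr p + p * m powr (p - 1) * (y i - m)))"
    proof -
      have "(\<Sum>i\<in>I. \<theta> i * (m powr p + p * m powr (p - 1) * (y i - m))) =
          (\<Sum>i\<in>I. \<theta> i * m powr p + p * m powr (p - 1) * (\<theta> i * y i) - p * m powr (p - 1) * (\<theta> i * m))"
        by (intro sum.cong) (auto simp: algebra_simps)
      also have "\<dots> = (\<Sum>i\<in>I. \<theta> i) * m powr p + p * m powr (p - 1) * m -
          p * m powr (p - 1) * ((\<Sum>i\<in>I. \<theta> i) * m)"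
        by (simp only: sum.distrib sum_subtractf sum_distrib_left[symmetric]
            sum_distrib_right[symmetric] m_def[symmetric])
      finally show ?thesis by (simp add: algebra_simps)
    qed
    also have "\<dots> \<le> (\<Sum>i\<in>I. \<theta> i * y i powr p)"
      using \<theta> y tangent by (intro sum_mono mult_left_mono) auto
    finally show ?thesis by (simp add: m_def)
  qed
qed

definition simplex_weights :: "'i set \<Rightarrow> ('i \<Rightarrow> real) set" where
  "simplex_weights I = {c. (\<forall>i\<in>I. c i \<ge> 0) \<and> (\<Sum>i\<in>I. c i) = 1}"

text \<open>The parameter \<open>\<epsilon>\<close> keeps the mean smooth; it is subtracted at the end so that the mean vanishes
  where all \<open>\<phi>\<^sub>i\<close> do.\<close>
definition power_mean ::
    "real \<Rightarrow> real \<Rightarrow> 'i set \<Rightarrow> ('i \<Rightarrow> 'a \<Rightarrow> real) \<Rightarrow> ('i \<Rightarrow> real) \<Rightarrow> 'a \<Rightarrow> real" where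
  "power_mean p \<epsilon> I \<phi> c x = (\<Sum>i\<in>I. c i * ((\<phi> i x)\<^sup>2 + \<epsilon>\<^sup>2) powr (p / 2)) powr (1 / p) - \<epsilon>"

lemma powr_half_eq: "\<epsilon> > 0 \<Longrightarrow> (\<epsilon>\<^sup>2) powr (p / 2) = \<epsilon> powr p" for \<epsilon> :: real
  by (simp add: powr_powr flip: powr_numeral)

locale power_mean_family =
  fixes p \<epsilon> :: real and I :: "'i set" and \<phi> :: "'i \<Rightarrow> 'a::euclidean_space \<Rightarrow> real" and \<Omega> :: "'a set"
  assumes p: "p > 1" and \<epsilon>: "\<epsilon> > 0" and I: "finite I"
    and \<phi>: "\<And>i. i \<in> I \<Longrightarrow> \<phi> i \<in> test_functions \<Omega>"
begin

abbreviation "V \<equiv> power_mean p \<epsilon> I \<phi>"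

text \<open>The radicand, equal to \<open>(V c x + \<epsilon>) powr p\<close>. It is linear in
  \<open>c\<close>, so estimates are made at this level.\<close>

definition "W c x = (\<Sum>i\<in>I. c i * ((\<phi> i x)\<^sup>2 + \<epsilon>\<^sup>2) powr (p / 2))" for c x

lemma V_eq: "V c x = W c x powr (1 / p) - \<epsilon>"
  by (simp add: power_mean_def W_def)

lemma g_pos: "(\<phi> i x)\<^sup>2 + \<epsilon>\<^sup>2 > 0"
  using \<epsilon> by (simp add: add_nonneg_pos)

lemma weights:
  assumes "c \<in> simplex_weights I"
  shows "\<And>i. i \<in> I \<Longrightarrow> c i \<ge> 0" "(\<Sum>i\<in>I. c i) = 1"
  using assms by (auto simp: simplex_weights_def)

text \<open>Every regularised square is at least \<open>\<epsilon>^2\<close> and the weights sum to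
  1. Staying away from 0 is what makes the outer root smooth.\<close>

lemma W_ge:
  assumes c: "c \<in> simplex_weights I"
  shows "W c x \<ge> \<epsilon> powr p"
proof -
  have "(\<Sum>i\<in>I. c i) * \<epsilon> powr p = (\<Sum>i\<in>I. c i * (\<epsilon>\<^sup>2) powr (p / 2))"
    using \<epsilon> by (simp add: sum_distrib_right powr_half_eq)
  also have "\<dots> \<le> W c x"
    unfolding W_def using weights[OF c] p \<epsilon>
    by (intro sum_mono mult_left_mono powr_mono2) auto
  finally show ?thesis by (simp add: weights[OF c])
qed

lemma W_pos: "c \<in> simplex_weights I \<Longrightarrow> W c x > 0"
  using W_ge[of c x] \<epsilon> by (simp add: order_less_le_trans[of 0 "\<epsilon> powr p"])

lemma V_nonneg: 
  assumes "c \<in> simplex_weights I"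
  shows "V c x \<ge> 0"
proof -
  have "(\<epsilon> powr p) powr (1 / p) \<le> W c x powr (1 / p)"
    using W_ge[OF assms, of x] p by (intro powr_mono2) auto
  then show ?thesis using p \<epsilon> by (simp add: V_eq powr_powr)
qed

lemma V_add_powr:
  assumes "c \<in> simplex_weights I"
  shows "(V c x + \<epsilon>) powr p = W c x"
  using W_pos[OF assms, of x] p by (simp add: V_eq powr_powr)

lemma W_ge_sum:
  assumes c: "c \<in> simplex_weights I"
  shows "(\<Sum>i\<in>I. c i * \<bar>\<phi> i x\<bar> powr p) \<le> W c x"
  unfolding W_def
proof (intro sum_mono mult_left_mono)
  fix i assume "i \<in> I"
  show "c i \<ge> 0" using weights[OF c] \<open>i \<in> I\<close> by simp
  have "\<bar>\<phi> i x\<bar> powr p = ((\<phi> i x)\<^sup>2) powr (p / 2)"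
  proof (cases "\<phi> i x = 0")
    case False
    then show ?thesis using powr_half_eq[of "\<bar>\<phi> i x\<bar>" p] by simp
  qed (use p in simp)
  also have "\<dots> \<le> ((\<phi> i x)\<^sup>2 + \<epsilon>\<^sup>2) powr (p / 2)"
    using p by (intro powr_mono2) auto
  finally show "\<bar>\<phi> i x\<bar> powr p \<le> ((\<phi> i x)\<^sup>2 + \<epsilon>\<^sup>2) powr (p / 2)" .
qed

lemma V_le:
  assumes c: "c \<in> simplex_weights I" and M: "\<And>i. i \<in> I \<Longrightarrow> \<bar>\<phi> i x\<bar> \<le> M" "M \<ge> 0"
  shows "V c x \<le> (M\<^sup>2 + \<epsilon>\<^sup>2) powr (1 / 2)"
proof -
  have "W c x \<le> (\<Sum>i\<in>I. c i * (M\<^sup>2 + \<epsilon>\<^sup>2) powr (p / 2))"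
    unfolding W_def
  proof (intro sum_mono mult_left_mono powr_mono2 add_right_mono)
    fix i assume "i \<in> I"
    then show "(\<phi> i x)\<^sup>2 \<le> M\<^sup>2" using M by (metis abs_ge_zero power2_abs power_mono)
  qed (use p weights[OF c] in auto)
  also have "\<dots> = (M\<^sup>2 + \<epsilon>\<^sup>2) powr (p / 2)"
    by (simp add: sum_distrib_right[symmetric] weights[OF c])
  finally have "W c x powr (1 / p) \<le> ((M\<^sup>2 + \<epsilon>\<^sup>2) powr (p / 2)) powr (1 / p)"
    using W_pos[OF c, of x] p by (intro powr_mono2) auto
  then show ?thesis using p \<epsilon> by (simp add: V_eq powr_powr)
qed

lemma V_smooth:
  assumes c: "c \<in> simplex_weights I"
  shows "continuously_differentiable n (V c)"
proof -
  have "continuously_differentiable n (\<lambda>x. W c x powr (1 / p) - \<epsilon>)"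
  proof (intro continuously_differentiable_diff continuously_differentiable_const
      continuously_differentiable_powr W_pos[OF c])
    show "continuously_differentiable n (W c)"
      unfolding W_def[abs_def] power2_eq_square
    proof (intro continuously_differentiable_sum continuously_differentiable_cmult
        continuously_differentiable_powr continuously_differentiable_add
        continuously_differentiable_mult continuously_differentiable_const)
      show "continuously_differentiable n (\<phi> i)" if "i \<in> I" for i
        using test_functions_smooth[OF \<phi>[OF that]] .
      then show "continuously_differentiable n (\<phi> i)" if "i \<in> I" for i using that .
      show "0 < \<phi> i x * \<phi> i x + \<epsilon> * \<epsilon>" for i x
        using g_pos[of i x] by (simp add: power2_eq_square)
    qed
  qed
  then show ?thesis by (simp add: V_eq[abs_def])
qed

text \<open>Where all \<phi> of positive weight vanish, the radicand is exactly
  \<open>\<epsilon> powr p\<close>. Only positive weights count, so the support of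
  \<open>V c\<close> follows the weights; the disjointness of supports rests on this.\<close>

lemma V_eq_0:
  assumes c: "c \<in> simplex_weights I" and "\<And>i. i \<in> I \<Longrightarrow> c i > 0 \<Longrightarrow> \<phi> i x = 0"
  shows "V c x = 0"
proof -
  have "W c x = (\<Sum>i\<in>I. c i * \<epsilon> powr p)"
    unfolding W_def
  proof (rule sum.cong)
    fix i assume "i \<in> I"
    then show "c i * ((\<phi> i x)\<^sup>2 + \<epsilon>\<^sup>2) powr (p / 2) = c i * \<epsilon> powr p"
      using assms(2)[of i] weights(1)[OF c, of i] powr_half_eq[OF \<epsilon>]
      by (cases "c i = 0") auto
  qed simp
  also have "\<dots> = \<epsilon> powr p" by (simp add: sum_distrib_right[symmetric] weights[OF c])
  finally show ?thesis using p \<epsilon> by (simp add: V_eq powr_powr)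
qed

lemma V_test_function:
  assumes c: "c \<in> simplex_weights I"
  shows "V c \<in> test_functions \<Omega>"
proof -
  have "\<forall>i\<in>I. \<exists>K. compact K \<and> K \<subseteq> \<Omega> \<and> (\<forall>x. x \<notin> K \<longrightarrow> \<phi> i x = 0)"
    using test_functions_support[OF \<phi>] by metis
  then obtain K where K: "\<And>i. i \<in> I \<Longrightarrow> compact (K i)" "\<And>i. i \<in> I \<Longrightarrow> K i \<subseteq> \<Omega>"
      "\<And>i x. i \<in> I \<Longrightarrow> x \<notin> K i \<Longrightarrow> \<phi> i x = 0"
    by metis
  show ?thesis
  proof (rule test_functionsI)
    show "compact (\<Union>i\<in>I. K i)" using K(1) I by (intro compact_UN) auto
    show "(\<Union>i\<in>I. K i) \<subseteq> \<Omega>" using K(2) by blast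
    show "V c x = 0" if "x \<notin> (\<Union>i\<in>I. K i)" for x
      using that K(3) by (intro V_eq_0[OF c]) auto
  qed (rule V_smooth[OF c])
qed

text \<open>The factor \<open>p\<close> from the inner powers cancels \<open>1 / p\<close> from the
  root. The explicit form is the source of the vanishing of the gradient, of its Jensen structure
  and of its continuity in \<open>c\<close>.\<close>

lemma gradient_V:
  assumes c: "c \<in> simplex_weights I"
  shows "gradient (V c) x = W c x powr (1 / p - 1) *\<^sub>R
    (\<Sum>i\<in>I. (c i * ((\<phi> i x)\<^sup>2 + \<epsilon>\<^sup>2) powr (p / 2 - 1) * \<phi> i x) *\<^sub>R gradient (\<phi> i) x)"
proof (rule gradient_eqI)
  have D\<phi>: "(\<phi> i has_derivative (\<lambda>h. gradient (\<phi> i) x \<bullet> h)) (at x)" if "i \<in> I" for i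
    by (rule has_derivative_gradient[OF smooth_differentiable[OF test_functions_smooth[OF \<phi>[OF that], of "Suc 0"]]])
  have Dg: "((\<lambda>x. c i * ((\<phi> i x)\<^sup>2 + \<epsilon>\<^sup>2) powr (p / 2)) has_derivative
      (\<lambda>h. p * (c i * ((\<phi> i x)\<^sup>2 + \<epsilon>\<^sup>2) powr (p / 2 - 1) * \<phi> i x * (gradient (\<phi> i) x \<bullet> h)))) (at x)"
    if "i \<in> I" for i
  proof -
    have "((\<lambda>t. c i * (t\<^sup>2 + \<epsilon>\<^sup>2) powr (p / 2)) has_real_derivative
        p * (c i * ((\<phi> i x)\<^sup>2 + \<epsilon>\<^sup>2) powr (p / 2 - 1) * \<phi> i x)) (at (\<phi> i x))"
    proof -
      have "((\<lambda>t. (t\<^sup>2 + \<epsilon>\<^sup>2) powr (p / 2)) has_real_derivative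
          (p / 2 * ((\<phi> i x)\<^sup>2 + \<epsilon>\<^sup>2) powr (p / 2 - 1)) * (2 * \<phi> i x)) (at (\<phi> i x))"
        by (rule DERIV_chain2[where f = "\<lambda>z. z powr (p / 2)" and g = "\<lambda>t. t\<^sup>2 + \<epsilon>\<^sup>2",
              OF has_real_derivative_powr[OF g_pos]])
           (auto intro!: derivative_eq_intros)
      from DERIV_cmult[OF this, of "c i"] show ?thesis by (simp add: mult_ac)
    qed
    then have "((\<lambda>t. c i * (t\<^sup>2 + \<epsilon>\<^sup>2) powr (p / 2)) has_derivative
        (\<lambda>h. p * (c i * ((\<phi> i x)\<^sup>2 + \<epsilon>\<^sup>2) powr (p / 2 - 1) * \<phi> i x) * h)) (at (\<phi> i x))"
      by (simp add: has_field_derivative_def)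
    from has_derivative_compose[OF D\<phi>[OF that] this] show ?thesis by (simp add: mult.assoc)
  qed
  have DW: "(W c has_derivative (\<lambda>h. \<Sum>i\<in>I.
      p * (c i * ((\<phi> i x)\<^sup>2 + \<epsilon>\<^sup>2) powr (p / 2 - 1) * \<phi> i x * (gradient (\<phi> i) x \<bullet> h)))) (at x)"
    unfolding W_def[abs_def] by (intro has_derivative_sum Dg)
  have "((\<lambda>t. t powr (1 / p) - \<epsilon>) has_real_derivative 1 / p * W c x powr (1 / p - 1)) (at (W c x))"
    using DERIV_diff[OF has_real_derivative_powr[OF W_pos[OF c], of "1 / p"] DERIV_const] by simp
  then have "((\<lambda>t. t powr (1 / p) - \<epsilon>) has_derivative (\<lambda>h. (1 / p * W c x powr (1 / p - 1)) * h)) (at (W c x))"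
    unfolding has_field_derivative_def .
  from has_derivative_compose[OF DW this]
  have "(V c has_derivative (\<lambda>h. (1 / p * W c x powr (1 / p - 1)) * (\<Sum>i\<in>I.
      p * (c i * ((\<phi> i x)\<^sup>2 + \<epsilon>\<^sup>2) powr (p / 2 - 1) * \<phi> i x * (gradient (\<phi> i) x \<bullet> h))))) (at x)"
    by (simp add: V_eq[abs_def])
  then show "(V c has_derivative (\<lambda>h. (W c x powr (1 / p - 1) *\<^sub>R
    (\<Sum>i\<in>I. (c i * ((\<phi> i x)\<^sup>2 + \<epsilon>\<^sup>2) powr (p / 2 - 1) * \<phi> i x) *\<^sub>R gradient (\<phi> i) x)) \<bullet> h)) (at x)"
    using p by (simp add: inner_sum_left sum_distrib_left[symmetric])
qed

text \<open>Each summand of the gradient carries the factor \<open>\<phi> i x\<close>, so it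
  vanishes at the very points where the relevant \<open>\<phi> i\<close> do, with no neighbourhood
  argument.\<close>

lemma gradient_V_eq_0:
  assumes c: "c \<in> simplex_weights I" and "\<And>i. i \<in> I \<Longrightarrow> c i > 0 \<Longrightarrow> \<phi> i x = 0"
  shows "gradient (V c) x = 0"
proof -
  have "c i * ((\<phi> i x)\<^sup>2 + \<epsilon>\<^sup>2) powr (p / 2 - 1) * \<phi> i x = 0" if "i \<in> I" for i
    using assms(2)[OF that] weights(1)[OF c that] by (cases "c i = 0") auto
  then show ?thesis unfolding gradient_V[OF c] by (subst sum.neutral) auto
qed

text \<open>Hidden convexity: Jensen's inequality with the weights \<open>c\<^sub>i f\<^sub>i\<^sup>p / W\<close>, where
  \<open>f\<^sub>i = (\<phi>\<^sub>i\<^sup>2 + \<epsilon>\<^sup>2)\<^bsup>1/2\<^esup>\<close>.\<close>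
lemma gradient_V_powr_le:
  assumes c: "c \<in> simplex_weights I"
  shows "norm (gradient (V c) x) powr p \<le> (\<Sum>i\<in>I. c i * norm (gradient (\<phi> i) x) powr p)"
proof -
  define g where "g i = (\<phi> i x)\<^sup>2 + \<epsilon>\<^sup>2" for i
  have g: "g i > 0" for i using g_pos by (simp add: g_def)
  define w where "w = W c x"
  have w: "w > 0" using W_pos[OF c] by (simp add: w_def)
  have w_eq: "w = (\<Sum>i\<in>I. c i * g i powr (p / 2))" by (simp add: w_def W_def g_def)
  define G where "G i = norm (gradient (\<phi> i) x)" for i
  \<comment> \<open>Two demands fix the \<open>y\<close> that follows:
    \<open>\<theta> i * y i\<close> is a term of the gradient bound, and in
    \<open>\<theta> i * y i powr p\<close> the powers of \<open>w\<close> and \<open>g i\<close>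
    cancel, leaving \<open>c i * G i powr p\<close>.\<close>
  define \<theta> where "\<theta> i = c i * g i powr (p / 2) / w" for i
  define y where "y i = w powr (1 / p) * g i powr (- 1 / 2) * G i" for i
  have "norm (gradient (V c) x) \<le>
      w powr (1 / p - 1) * (\<Sum>i\<in>I. \<bar>c i * g i powr (p / 2 - 1) * \<phi> i x\<bar> * G i)"
    unfolding gradient_V[OF c] w_def[symmetric] g_def[symmetric] G_def
    by (simp add: mult_left_mono sum_norm_le)
  \<comment> \<open>As \<open>\<bar>\<phi> i x\<bar> \<le> g i powr (1 / 2)\<close>, the
    regularisation does not raise the energy.\<close>
  also have "\<dots> \<le> w powr (1 / p - 1) * (\<Sum>i\<in>I. c i * g i powr (p / 2 - 1 / 2) * G i)"
  proof (intro mult_left_mono sum_mono mult_right_mono)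
    fix i assume i: "i \<in> I"
    have "\<bar>\<phi> i x\<bar> = ((\<phi> i x)\<^sup>2) powr (1 / 2)" by (simp add: powr_half_sqrt)
    also have "\<dots> \<le> g i powr (1 / 2)" by (intro powr_mono2) (auto simp: g_def)
    finally have "\<bar>c i * g i powr (p / 2 - 1) * \<phi> i x\<bar> \<le> c i * g i powr (p / 2 - 1) * g i powr (1 / 2)"
      using weights(1)[OF c i] by (simp add: abs_mult mult_left_mono)
    also have "\<dots> = c i * g i powr (p / 2 - 1 / 2)"
      by (simp add: mult.assoc powr_add[symmetric])
    finally show "\<bar>c i * g i powr (p / 2 - 1) * \<phi> i x\<bar> \<le> c i * g i powr (p / 2 - 1 / 2)" .
  qed (auto simp: G_def)
  also have "\<dots> = (\<Sum>i\<in>I. \<theta> i * y i)"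
    unfolding sum_distrib_left
  proof (rule sum.cong)
    fix i assume "i \<in> I"
    have "w powr (1 / p - 1) = w powr (1 / p) / w"
      using w by (simp add: powr_diff)
    moreover have "g i powr (p / 2 - 1 / 2) = g i powr (p / 2) * g i powr (- 1 / 2)"
      by (simp add: powr_add[symmetric])
    ultimately show "w powr (1 / p - 1) * (c i * g i powr (p / 2 - 1 / 2) * G i) = \<theta> i * y i"
      by (simp add: \<theta>_def y_def)
  qed simp
  finally have "norm (gradient (V c) x) powr p \<le> (\<Sum>i\<in>I. \<theta> i * y i) powr p"
    using p by (intro powr_mono2) auto
  also have "\<dots> \<le> (\<Sum>i\<in>I. \<theta> i * y i powr p)"
  proof (rule powr_convex_nonneg)
    show "(\<Sum>i\<in>I. \<theta> i) = 1"
      unfolding \<theta>_def sum_divide_distrib[symmetric] w_eq[symmetric] using w by simp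
  qed (use p I w weights(1)[OF c] in \<open>auto simp: \<theta>_def y_def G_def\<close>)
  also have "\<dots> = (\<Sum>i\<in>I. c i * G i powr p)"
  proof (rule sum.cong)
    fix i assume "i \<in> I"
    have "y i powr p = w * g i powr (- (p / 2)) * G i powr p"
      using w p g[of i] by (simp add: y_def powr_mult powr_powr G_def)
    then show "\<theta> i * y i powr p = c i * G i powr p"
      using w g[of i] by (simp add: \<theta>_def powr_minus field_simps)
  qed simp
  finally show ?thesis by (simp add: G_def)
qed

lemma
  assumes c: "\<And>n. c n \<in> simplex_weights I" "c' \<in> simplex_weights I"
    and lim: "\<And>i. i \<in> I \<Longrightarrow> (\<lambda>n. c n i) \<longlonglongrightarrow> c' i"
  shows tendsto_V: "(\<lambda>n. V (c n) x) \<longlonglongrightarrow> V c' x"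
    and tendsto_gradient_V: "(\<lambda>n. gradient (V (c n)) x) \<longlonglongrightarrow> gradient (V c') x"
proof -
  have W: "(\<lambda>n. W (c n) x) \<longlonglongrightarrow> W c' x"
    unfolding W_def by (intro tendsto_intros lim)
  show "(\<lambda>n. V (c n) x) \<longlonglongrightarrow> V c' x"
    unfolding V_eq using W_pos[OF c(2), of x] by (intro tendsto_intros W) auto
  show "(\<lambda>n. gradient (V (c n)) x) \<longlonglongrightarrow> gradient (V c') x"
    unfolding gradient_V[OF c(1)] gradient_V[OF c(2)]
    using W_pos[OF c(2), of x] by (intro tendsto_intros W lim) auto
qed

lemma integral_gradient_V_le:
  assumes c: "c \<in> simplex_weights I"
    and \<Lambda>: "\<And>i. i \<in> I \<Longrightarrow> (\<integral>x. norm (gradient (\<phi> i) x) powr p \<partial>lborel) \<le> \<Lambda>"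
  shows "(\<integral>x. norm (gradient (V c) x) powr p \<partial>lborel) \<le> \<Lambda>"
proof -
  have int: "integrable lborel (\<lambda>x. norm (gradient (\<phi> i) x) powr p)" if "i \<in> I" for i
    using integrable_test_function_powr(2)[OF \<phi>[OF that]] p by simp
  have "(\<integral>x. norm (gradient (V c) x) powr p \<partial>lborel) \<le>
      (\<integral>x. (\<Sum>i\<in>I. c i * norm (gradient (\<phi> i) x) powr p) \<partial>lborel)"
    using int p by (intro integral_mono gradient_V_powr_le[OF c]
        integrable_test_function_powr(2)[OF V_test_function[OF c]]) auto
  also have "\<dots> = (\<Sum>i\<in>I. c i * (\<integral>x. norm (gradient (\<phi> i) x) powr p \<partial>lborel))"
    using int by (subst Bochner_Integration.integral_sum) auto
  also have "\<dots> \<le> (\<Sum>i\<in>I. c i * \<Lambda>)"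
    using \<Lambda> weights[OF c] by (intro sum_mono mult_left_mono) auto
  also have "\<dots> = \<Lambda>" by (simp add: sum_distrib_right[symmetric] weights[OF c])
  finally show ?thesis .
qed

end

text \<open>On \<Omega> the mean of the \<open>\<bar>\<phi> i x\<bar> powr p\<close> is at most
  \<open>(V c x + \<epsilon>) powr p\<close>, hence at most
  \<open>(1 + \<eta>) * V c x powr p + C * \<epsilon> powr p\<close>. No constant involves
  \<open>c\<close>, so one \<open>\<epsilon>\<close> serves all weights, and the bounded domain
  keeps the integrated error finite.\<close>

lemma power_mean_mass_ge:
  fixes \<phi> :: "'i \<Rightarrow> 'a::euclidean_space \<Rightarrow> real"
  assumes p: "p > 1" and I: "finite I" and \<Omega>: "open \<Omega>" "bounded \<Omega>"
    and \<phi>: "\<And>i. i \<in> I \<Longrightarrow> \<phi> i \<in> test_functions \<Omega>"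
    and \<kappa>: "\<And>i. i \<in> I \<Longrightarrow> (\<integral>x. \<bar>\<phi> i x\<bar> powr p \<partial>lborel) = \<kappa>"
    and m: "0 < m" "m < \<kappa>"
  obtains \<epsilon> where "\<epsilon> > 0"
    "\<And>c. c \<in> simplex_weights I \<Longrightarrow> m \<le> (\<integral>x. \<bar>power_mean p \<epsilon> I \<phi> c x\<bar> powr p \<partial>lborel)"
proof -
  \<comment> \<open>The midpoint divides the admissible loss: the term in \<open>\<epsilon>\<close>
    may cost \<open>\<kappa> - \<kappa>'\<close>, and the factor \<open>1 + \<eta>\<close> accounts
    for the rest, down to \<open>m\<close>.\<close>
  define \<kappa>' where "\<kappa>' = (\<kappa> + m) / 2"
  have \<kappa>': "m < \<kappa>'" "\<kappa>' < \<kappa>" using m by (auto simp: \<kappa>'_def)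
  define \<eta> where "\<eta> = \<kappa>' / m - 1"
  have \<eta>: "\<eta> > 0" "(1 + \<eta>) * m = \<kappa>'" using \<kappa>' m by (auto simp: \<eta>_def field_simps)
  obtain C where C: "C \<ge> 0"
      "\<And>a b. a \<ge> 0 \<Longrightarrow> b \<ge> 0 \<Longrightarrow> (a + b) powr p \<le> (1 + \<eta>) * a powr p + C * b powr p"
    using powr_add_le[of p \<eta>] \<eta> p by auto
  define vol where "vol = measure lborel \<Omega>"
  have vol: "vol \<ge> 0" by (simp add: vol_def)
  define \<epsilon> where "\<epsilon> = ((\<kappa> - \<kappa>') / (C * vol + 1)) powr (1 / p)"
  have Cv: "C * vol + 1 > 0" using C vol by (simp add: add_nonneg_pos)
  have \<epsilon>: "\<epsilon> > 0" "\<epsilon> powr p = (\<kappa> - \<kappa>') / (C * vol + 1)"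
    using \<kappa>' Cv p by (auto simp: \<epsilon>_def powr_powr)
  have "C * vol * ((\<kappa> - \<kappa>') / (C * vol + 1)) \<le> (C * vol + 1) * ((\<kappa> - \<kappa>') / (C * vol + 1))"
    using \<kappa>' Cv by (intro mult_right_mono) auto
  then have \<epsilon>': "C * \<epsilon> powr p * vol \<le> \<kappa> - \<kappa>'"
    using Cv by (simp add: \<epsilon> mult_ac)
  interpret power_mean_family p \<epsilon> I \<phi> \<Omega>
    using p \<epsilon> I \<phi> by unfold_locales
  have emeas: "emeasure lborel \<Omega> < \<infinity>"
    using emeasure_bounded_finite[OF \<Omega>(2)] .
  show thesis
  proof (rule that[OF \<epsilon>(1)])
    fix c assume c: "c \<in> simplex_weights I"
    have int: "integrable lborel (\<lambda>x. \<bar>\<phi> i x\<bar> powr p)" if "i \<in> I" for i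
      using integrable_test_function_powr(1)[OF \<phi>[OF that]] p by simp
    have intV: "integrable lborel (\<lambda>x. \<bar>V c x\<bar> powr p)"
      using integrable_test_function_powr(1)[OF V_test_function[OF c]] p by simp
    have ind: "integrable lborel (indicator \<Omega> :: 'a \<Rightarrow> real)"
      using \<Omega>(1) emeas by (intro integrable_real_indicator) auto
    have "\<kappa> = (\<Sum>i\<in>I. c i * (\<integral>x. \<bar>\<phi> i x\<bar> powr p \<partial>lborel))"
      using weights[OF c] by (simp add: \<kappa> sum_distrib_right[symmetric])
    also have "\<dots> = (\<integral>x. (\<Sum>i\<in>I. c i * \<bar>\<phi> i x\<bar> powr p) \<partial>lborel)"
      using int by (subst Bochner_Integration.integral_sum) auto
    also have "\<dots> \<le> (\<integral>x. (1 + \<eta>) * \<bar>V c x\<bar> powr p + C * \<epsilon> powr p * indicator \<Omega> x \<partial>lborel)"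
    proof (rule integral_mono)
      show "(\<Sum>i\<in>I. c i * \<bar>\<phi> i x\<bar> powr p) \<le>
          (1 + \<eta>) * \<bar>V c x\<bar> powr p + C * \<epsilon> powr p * indicator \<Omega> x" for x
      proof (cases "x \<in> \<Omega>")
        case True
        have "(\<Sum>i\<in>I. c i * \<bar>\<phi> i x\<bar> powr p) \<le> (V c x + \<epsilon>) powr p"
          using W_ge_sum[OF c] by (simp add: V_add_powr[OF c])
        also have "\<dots> \<le> (1 + \<eta>) * V c x powr p + C * \<epsilon> powr p"
          using V_nonneg[OF c] \<epsilon> by (intro C) auto
        finally show ?thesis using True V_nonneg[OF c, of x] by simp
      next
        case False
        then have "(\<Sum>i\<in>I. c i * \<bar>\<phi> i x\<bar> powr p) = 0"
          using test_function_eq_0[OF \<phi>] by (intro sum.neutral) auto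
        then show ?thesis using \<eta>(1) False by simp
      qed
    qed (use int intV ind in auto)
    also have "\<dots> = (1 + \<eta>) * (\<integral>x. \<bar>V c x\<bar> powr p \<partial>lborel) + C * \<epsilon> powr p * vol"
      using intV ind \<Omega>(1) by (simp add: vol_def)
    finally have "\<kappa>' \<le> (1 + \<eta>) * (\<integral>x. \<bar>V c x\<bar> powr p \<partial>lborel)"
      using \<epsilon>' by linarith
    then have "(1 + \<eta>) * m \<le> (1 + \<eta>) * (\<integral>x. \<bar>V c x\<bar> powr p \<partial>lborel)"
      by (simp add: \<eta>(2))
    then show "m \<le> (\<integral>x. \<bar>V c x\<bar> powr p \<partial>lborel)"
      using \<eta>(1) by simp
  qed
qed

subsection \<open>Odd maps built from power means\<close>

lemma tendsto_integral_norm_powr: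
  fixes f :: "nat \<Rightarrow> 'a::euclidean_space \<Rightarrow> 'b::euclidean_space"
  assumes p: "p > 0" and \<Omega>: "open \<Omega>" "bounded \<Omega>"
    and meas: "\<And>n. f n \<in> borel_measurable borel" "g \<in> borel_measurable borel"
    and B: "\<And>n x. norm (f n x) \<le> B" and zero: "\<And>n x. x \<notin> \<Omega> \<Longrightarrow> f n x = 0"
    and lim: "\<And>x. (\<lambda>n. f n x) \<longlonglongrightarrow> g x"
  shows "(\<lambda>n. \<integral>x. norm (f n x) powr p \<partial>lborel) \<longlonglongrightarrow> (\<integral>x. norm (g x) powr p \<partial>lborel)"
proof (rule integral_dominated_convergence[where w = "\<lambda>x. B powr p * indicator \<Omega> x"])
  have "emeasure lborel \<Omega> < \<infinity>" by (rule emeasure_bounded_finite[OF \<Omega>(2)])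
  then show "integrable lborel (\<lambda>x. B powr p * indicator \<Omega> x)"
    using \<Omega>(1) by (intro integrable_mult_right integrable_real_indicator) auto
  show "AE x in lborel. (\<lambda>n. norm (f n x) powr p) \<longlonglongrightarrow> norm (g x) powr p"
    using p by (intro AE_I2 tendsto_powr' tendsto_norm lim tendsto_const) auto
  show "AE x in lborel. norm (norm (f n x) powr p) \<le> B powr p * indicator \<Omega> x" for n
  proof (rule AE_I2)
    fix x
    show "norm (norm (f n x) powr p) \<le> B powr p * indicator \<Omega> x"
      using B[of n x] zero[of x n] p by (cases "x \<in> \<Omega>") (auto intro: powr_mono2)
  qed
qed (use meas in auto)

text \<open>The domain is metric, so continuity may be tested on sequences: if no ball around
  \<open>s\<close> worked, points \<open>X n\<close> within \<open>1 / (n + 1)\<close> of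
  \<open>s\<close> would have images outside the open set, against convergence in the seminorm that
  defines the topology.\<close>

lemma continuous_map_W0pI:
  fixes S :: "'s::metric_space set"
  assumes mem: "\<And>s. s \<in> S \<Longrightarrow> h s \<in> Lp_sphere p \<Omega>"
    and lim: "\<And>X s. (\<And>n. X n \<in> S) \<Longrightarrow> s \<in> S \<Longrightarrow> X \<longlonglongrightarrow> s \<Longrightarrow>
      (\<lambda>n. W1p_norm p \<Omega> (\<lambda>x. h (X n) x - h s x)) \<longlonglongrightarrow> 0"
  shows "continuous_map (top_of_set S) (subtopology (W0p_topology p \<Omega>) (Lp_sphere p \<Omega>)) h"
proof -
  have W: "h s \<in> W0p p \<Omega>" if "s \<in> S" for s
    using mem[OF that] by (simp add: Lp_sphere_def)
  have top: "topspace (W0p_topology p \<Omega>) = W0p p \<Omega>"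
  proof
    show "topspace (W0p_topology p \<Omega>) \<subseteq> W0p p \<Omega>"
      using openin_W0p_topology openin_topspace by blast
    have "openin (W0p_topology p \<Omega>) (W0p p \<Omega>)"
      unfolding openin_W0p_topology by (auto intro: exI[of _ 1])
    then show "W0p p \<Omega> \<subseteq> topspace (W0p_topology p \<Omega>)" by (rule openin_subset)
  qed
  have "openin (top_of_set S) {s \<in> S. h s \<in> U}" if U: "openin (W0p_topology p \<Omega>) U" for U
    unfolding openin_contains_ball
  proof (intro conjI ballI)
    fix s assume s: "s \<in> {s \<in> S. h s \<in> U}"
    then obtain e where e: "e > 0"
        "\<And>v. v \<in> W0p p \<Omega> \<Longrightarrow> W1p_norm p \<Omega> (\<lambda>x. v x - h s x) < e \<Longrightarrow> v \<in> U"
      using U unfolding openin_W0p_topology by blast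
    show "\<exists>d>0. ball s d \<inter> S \<subseteq> {s \<in> S. h s \<in> U}"
    proof (rule ccontr)
      assume *: "\<not> ?thesis"
      have "\<exists>t. t \<in> ball s (inverse (real (Suc n))) \<inter> S \<and> h t \<notin> U" for n
        using * by (force dest: spec[of _ "inverse (real (Suc n))"])
      then obtain X where X: "\<And>n. X n \<in> ball s (inverse (real (Suc n))) \<inter> S" "\<And>n. h (X n) \<notin> U"
        by metis
      have "X \<longlonglongrightarrow> s"
      proof (rule tendsto_dist_iff[THEN iffD2], rule tendsto_sandwich[OF _ _ tendsto_const])
        show "\<forall>\<^sub>F n in sequentially. dist (X n) s \<le> inverse (real (Suc n))"
          using X(1) by (auto simp: dist_commute less_imp_le)
      qed (auto intro: LIMSEQ_inverse_real_of_nat simp del: of_nat_Suc)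
      with X(1) s have "(\<lambda>n. W1p_norm p \<Omega> (\<lambda>x. h (X n) x - h s x)) \<longlonglongrightarrow> 0"
        by (intro lim) auto
      then have "\<forall>\<^sub>F n in sequentially. W1p_norm p \<Omega> (\<lambda>x. h (X n) x - h s x) < e"
        using e(1) by (rule order_tendstoD)
      then obtain n where "W1p_norm p \<Omega> (\<lambda>x. h (X n) x - h s x) < e"
        by (auto simp: eventually_sequentially)
      with e(2)[OF W] X show False by blast
    qed
  qed blast
  then have "continuous_map (top_of_set S) (W0p_topology p \<Omega>) h"
    using W by (auto simp: continuous_map_def top)
  with mem show ?thesis by (auto simp: continuous_map_in_subtopology)
qed

text \<open>On functions from a countable index type the product topology is the type class
  topology, which comes from a metric; this opens the sphere to sequential arguments.\<close>

lemma nsphere_top_of_set: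
  "nsphere n = top_of_set {x. (\<Sum>i\<le>n. x i ^ 2) = 1 \<and> (\<forall>i>n. x i = 0)}"
  by (simp add: nsphere euclidean_product_topology)

text \<open>The smaller sphere is the equator of the next one, literally a subset because the
  remaining coordinates are 0. So \<open>h\<close> itself restricts to a competitor, with a supremum
  over fewer points.\<close>

lemma cogenus_eigenvalue_mono:
  assumes "k \<ge> 1"
  shows "cogenus_eigenvalue k p \<Omega> \<le> cogenus_eigenvalue (k + 1) p \<Omega>"
  unfolding cogenus_eigenvalue_def
proof (rule INF_mono)
  fix h assume h: "h \<in> odd_maps (k + 1) p \<Omega>"
  obtain m where k: "k = Suc m" using assms by (cases k) auto
  have eq: "nsphere m = subtopology (nsphere (Suc m)) {x. x (Suc m) = 0}"
    by (simp add: subtopology_nsphere_equator)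
  then have sub: "topspace (nsphere m) \<subseteq> topspace (nsphere (Suc m))" by auto
  have "h \<in> odd_maps k p \<Omega>"
    using h sub unfolding odd_maps_def k
    by (auto simp: eq intro: continuous_map_from_subtopology)
  moreover have "(SUP u\<in>h ` topspace (nsphere (k - 1)). ereal (dirichlet_energy p \<Omega> u)) \<le>
      (SUP u\<in>h ` topspace (nsphere (k + 1 - 1)). ereal (dirichlet_energy p \<Omega> u))"
    using sub by (intro SUP_subset_mono image_mono) (auto simp: k)
  ultimately show "\<exists>h'\<in>odd_maps k p \<Omega>.
      (SUP u\<in>h' ` topspace (nsphere (k - 1)). ereal (dirichlet_energy p \<Omega> u)) \<le>
      (SUP u\<in>h ` topspace (nsphere (k + 1 - 1)). ereal (dirichlet_energy p \<Omega> u))" by blast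
qed

text \<open>At most one of the two terms survives, so p-th powers add without cross terms. This
  serves both values and gradients.\<close>

lemma norm_diff_powr_if_zero:
  fixes v w :: "'b::real_normed_vector"
  assumes "p > 0" "a \<ge> 0" "b \<ge> 0" and "a = 0 \<or> v = 0 \<or> b = 0 \<or> w = 0"
  shows "norm (a *\<^sub>R v - b *\<^sub>R w) powr p = a powr p * norm v powr p + b powr p * norm w powr p"
  using assms by (auto simp: powr_mult)

text \<open>Collects what the construction asks of the sphere. Disjointness is demanded only where
  both cutoffs are positive; elsewhere a single term is left. The lower bound \<open>m\<close> on
  the mass is uniform over all weights, \<open>\<Lambda>\<close> bounds the energies of the
  family.\<close>

locale sphere_family = power_mean_family p \<epsilon> I \<phi> \<Omega>
  for p \<epsilon> :: real and I :: "'i set" and \<phi> :: "'i \<Rightarrow> 'a::euclidean_space \<Rightarrow> real" and \<Omega> +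
  fixes S :: "'s::metric_space set" and neg :: "'s \<Rightarrow> 's" and a :: "'s \<Rightarrow> real"
    and c :: "'s \<Rightarrow> 'i \<Rightarrow> real" and A \<Lambda> m :: real
  assumes \<Omega>: "open \<Omega>" "bounded \<Omega>"
    and neg: "\<And>s. s \<in> S \<Longrightarrow> neg s \<in> S" "\<And>s. neg (neg s) = s" "continuous_on S neg"
    and a: "\<And>s. s \<in> S \<Longrightarrow> 0 \<le> a s" "\<And>s. s \<in> S \<Longrightarrow> a s \<le> A" "continuous_on S a"
      "\<And>s. s \<in> S \<Longrightarrow> a s > 0 \<or> a (neg s) > 0"
    and c: "\<And>i. i \<in> I \<Longrightarrow> continuous_on S (\<lambda>s. c s i)"
      "\<And>s. s \<in> S \<Longrightarrow> c s \<in> simplex_weights I"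
    and disjoint: "\<And>s i j x. s \<in> S \<Longrightarrow> a s > 0 \<Longrightarrow> a (neg s) > 0 \<Longrightarrow> i \<in> I \<Longrightarrow> j \<in> I \<Longrightarrow>
      c s i > 0 \<Longrightarrow> c (neg s) j > 0 \<Longrightarrow> \<phi> i x \<noteq> 0 \<Longrightarrow> \<phi> j x = 0"
    and m: "m > 0" "\<And>w. w \<in> simplex_weights I \<Longrightarrow> m \<le> (\<integral>x. \<bar>V w x\<bar> powr p \<partial>lborel)"
    and \<Lambda>: "\<And>i. i \<in> I \<Longrightarrow> (\<integral>x. norm (gradient (\<phi> i) x) powr p \<partial>lborel) \<le> \<Lambda>"
begin

definition "h0 s x = a s * V (c s) x - a (neg s) * V (c (neg s)) x" for s x

lemma h0_test_function: "s \<in> S \<Longrightarrow> h0 s \<in> test_functions \<Omega>"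
  unfolding h0_def[abs_def]
  by (intro test_functions_diff test_functions_cmult V_test_function c neg)

lemma gradient_h0:
  assumes "s \<in> S"
  shows "gradient (h0 s) x = a s *\<^sub>R gradient (V (c s)) x - a (neg s) *\<^sub>R gradient (V (c (neg s))) x"
proof -
  have D: "(\<lambda>x. k * V w x) differentiable (at x)" "V w differentiable (at x)"
    if "w \<in> simplex_weights I" for k w x
    using that V_test_function test_functions_cmult test_functions_smooth smooth_differentiable
    by metis+
  show ?thesis
    unfolding h0_def[abs_def] using D c(2) assms neg(1) by (simp add: gradient_diff gradient_cmult)
qed

lemma disjoint_cases:
  assumes s: "s \<in> S"
  shows "a s = 0 \<or> V (c s) x = 0 \<or> a (neg s) = 0 \<or> V (c (neg s)) x = 0"
    and "a s = 0 \<or> gradient (V (c s)) x = 0 \<or> a (neg s) = 0 \<or> gradient (V (c (neg s))) x = 0"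
proof -
  have pos: "a s > 0" "a (neg s) > 0" if "a s \<noteq> 0" "a (neg s) \<noteq> 0"
    using a(1)[OF s] a(1)[OF neg(1)[OF s]] that by auto
  have "(\<forall>i\<in>I. c s i > 0 \<longrightarrow> \<phi> i x = 0) \<or> (\<forall>j\<in>I. c (neg s) j > 0 \<longrightarrow> \<phi> j x = 0)"
    if "a s \<noteq> 0" "a (neg s) \<noteq> 0"
    using disjoint[OF s pos[OF that]] by blast
  then show "a s = 0 \<or> V (c s) x = 0 \<or> a (neg s) = 0 \<or> V (c (neg s)) x = 0"
    and "a s = 0 \<or> gradient (V (c s)) x = 0 \<or> a (neg s) = 0 \<or> gradient (V (c (neg s))) x = 0"
    using V_eq_0[OF c(2)[OF s], of x] V_eq_0[OF c(2)[OF neg(1)[OF s]], of x]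
      gradient_V_eq_0[OF c(2)[OF s], of x] gradient_V_eq_0[OF c(2)[OF neg(1)[OF s]], of x]
    by blast+
qed

definition "mass s = (\<integral>x. \<bar>h0 s x\<bar> powr p \<partial>lborel)" for s

text \<open>Both integrals are compared with the same factor. It depends on \<open>s\<close>, but
  cancels in the quotient of energy and mass and leaves \<open>\<Lambda> / m\<close>.\<close>

lemma h0_integrals:
  assumes s: "s \<in> S"
  shows "m * (a s powr p + a (neg s) powr p) \<le> mass s"
    and "(\<integral>x. norm (gradient (h0 s) x) powr p \<partial>lborel) \<le> \<Lambda> * (a s powr p + a (neg s) powr p)"
proof -
  note s' = neg(1)[OF s]
  note w = c(2)[OF s] c(2)[OF s']
  note int = w[THEN V_test_function, THEN integrable_test_function_powr(1), of p]
    w[THEN V_test_function, THEN integrable_test_function_powr(2), of p]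
  have p0: "p > 0" using p by simp
  have "\<bar>h0 s x\<bar> powr p = a s powr p * \<bar>V (c s) x\<bar> powr p + a (neg s) powr p * \<bar>V (c (neg s)) x\<bar> powr p" for x
    using norm_diff_powr_if_zero[OF p0 a(1)[OF s] a(1)[OF s'] disjoint_cases(1)[OF s, of x]]
    by (simp add: h0_def)
  then have "mass s = a s powr p * (\<integral>x. \<bar>V (c s) x\<bar> powr p \<partial>lborel) +
      a (neg s) powr p * (\<integral>x. \<bar>V (c (neg s)) x\<bar> powr p \<partial>lborel)"
    using int p0 by (simp add: mass_def)
  moreover have "a s powr p * m \<le> a s powr p * (\<integral>x. \<bar>V (c s) x\<bar> powr p \<partial>lborel)"
      "a (neg s) powr p * m \<le> a (neg s) powr p * (\<integral>x. \<bar>V (c (neg s)) x\<bar> powr p \<partial>lborel)"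
    using m(2) w by (auto intro!: mult_left_mono)
  ultimately show "m * (a s powr p + a (neg s) powr p) \<le> mass s"
    by (simp add: algebra_simps)
  have "norm (gradient (h0 s) x) powr p = a s powr p * norm (gradient (V (c s)) x) powr p +
      a (neg s) powr p * norm (gradient (V (c (neg s))) x) powr p" for x
    using norm_diff_powr_if_zero[OF p0 a(1)[OF s] a(1)[OF s'] disjoint_cases(2)[OF s, of x]]
    by (simp add: gradient_h0[OF s])
  then have "(\<integral>x. norm (gradient (h0 s) x) powr p \<partial>lborel) =
      a s powr p * (\<integral>x. norm (gradient (V (c s)) x) powr p \<partial>lborel) +
      a (neg s) powr p * (\<integral>x. norm (gradient (V (c (neg s))) x) powr p \<partial>lborel)"
    using int p0 by simp
  also have "\<dots> \<le> a s powr p * \<Lambda> + a (neg s) powr p * \<Lambda>"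
    using integral_gradient_V_le[OF _ \<Lambda>] w by (intro add_mono mult_left_mono) auto
  finally show "(\<integral>x. norm (gradient (h0 s) x) powr p \<partial>lborel) \<le> \<Lambda> * (a s powr p + a (neg s) powr p)"
    by (simp add: algebra_simps)
qed

lemma weight_pos: 
  assumes s: "s \<in> S"
  shows "a s powr p + a (neg s) powr p > 0"
  using a(4)[OF s] by (auto intro: add_pos_nonneg add_nonneg_pos)

lemma mass_pos: "s \<in> S \<Longrightarrow> mass s > 0"
  using h0_integrals(1)[of s] mult_pos_pos[OF m(1) weight_pos[of s]] by linarith

lemma h0_neg: "h0 (neg s) x = - h0 s x"
  by (simp add: h0_def neg(2))

definition "coef s = mass s powr (- 1 / p)" for s

definition "h s x = coef s * h0 s x" for s x

lemma h_test_function: "s \<in> S \<Longrightarrow> h s \<in> test_functions \<Omega>"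
  unfolding h_def[abs_def] by (intro test_functions_cmult h0_test_function)

lemma gradient_h:
  assumes "s \<in> S"
  shows "gradient (h s) x = coef s *\<^sub>R gradient (h0 s) x"
  unfolding h_def[abs_def]
  by (rule gradient_cmult, rule smooth_differentiable, rule test_functions_smooth)
     (rule h0_test_function[OF assms])

lemma coef_powr: "s \<in> S \<Longrightarrow> coef s powr p = 1 / mass s"
  unfolding coef_def powr_powr using mass_pos[of s] p by (simp add: powr_minus_divide)

lemma coef_nonneg: "coef s \<ge> 0"
  by (simp add: coef_def)

lemma h_Lp_sphere:
  assumes s: "s \<in> S"
  shows "h s \<in> Lp_sphere p \<Omega>"
proof -
  have "(\<integral>x. \<bar>h s x\<bar> powr p \<partial>lborel) = (\<integral>x. coef s powr p * \<bar>h0 s x\<bar> powr p \<partial>lborel)"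
    using coef_nonneg[of s] by (simp add: h_def abs_mult powr_mult)
  also have "\<dots> = 1"
    using mass_pos[OF s] by (simp add: coef_powr[OF s] mass_def[symmetric])
  finally show ?thesis
    using h_test_function[OF s] p \<Omega>
    by (simp add: Lp_sphere_def test_functions_W0p Lp_integral_test_function)
qed

lemma dirichlet_energy_h:
  assumes s: "s \<in> S"
  shows "dirichlet_energy p \<Omega> (h s) \<le> \<Lambda> / m"
proof -
  let ?w = "a s powr p + a (neg s) powr p"
  have "dirichlet_energy p \<Omega> (h s) = (\<integral>x. coef s powr p * norm (gradient (h0 s) x) powr p \<partial>lborel)"
    using h_test_function[OF s] p \<Omega> coef_nonneg[of s]
    by (simp add: dirichlet_energy_test_function gradient_h[OF s] powr_mult)
  also have "\<dots> = (\<integral>x. norm (gradient (h0 s) x) powr p \<partial>lborel) / mass s"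
    by (simp add: coef_powr[OF s])
  also have "\<dots> \<le> (\<integral>x. norm (gradient (h0 s) x) powr p \<partial>lborel) / (m * ?w)"
    using h0_integrals(1)[OF s] m(1) weight_pos[OF s] mass_pos[OF s] by (intro divide_left_mono) auto
  also have "\<dots> \<le> (\<Lambda> * ?w) / (m * ?w)"
    using h0_integrals(2)[OF s] m(1) weight_pos[OF s] by (intro divide_right_mono) auto
  also have "\<dots> = \<Lambda> / m" using weight_pos[OF s] by simp
  finally show ?thesis .
qed

lemma h_neg: "h (neg s) x = - h s x"
proof -
  have "mass (neg s) = mass s" by (simp add: mass_def h0_neg)
  then show ?thesis by (simp add: h_def coef_def h0_neg)
qed

text \<open>Bounds uniform in \<open>s\<close> and \<open>x\<close> serve as majorants for dominated
  convergence. The one on gradients is the hidden convexity inequality read pointwise.\<close>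

lemma h0_bounded:
  obtains B where "B \<ge> 0" "\<And>s x. s \<in> S \<Longrightarrow> norm (h0 s x) \<le> B"
    "\<And>s x. s \<in> S \<Longrightarrow> norm (gradient (h0 s) x) \<le> B"
proof -
  have "\<exists>C\<ge>0. \<forall>x. \<bar>\<phi> i x\<bar> \<le> C \<and> norm (gradient (\<phi> i) x) \<le> C" if i: "i \<in> I" for i
  proof -
    obtain K where K: "compact K" "K \<subseteq> \<Omega>" "\<And>x. x \<notin> K \<Longrightarrow> \<phi> i x = 0"
      using \<phi>[OF i] by (rule test_functions_support) blast
    have cont: "continuous_on UNIV (\<phi> i)" "continuous_on UNIV (gradient (\<phi> i))"
      using test_functions_smooth[OF \<phi>[OF i], of 0]
        continuous_gradient[OF test_functions_smooth[OF \<phi>[OF i]]] by auto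
    have "gradient (\<phi> i) x = 0" if "x \<notin> K" for x
      using K that by (intro gradient_eq_0_outside[of K]) (auto simp: compact_imp_closed)
    then obtain D where D: "D \<ge> 0" "\<And>x. norm (gradient (\<phi> i) x) \<le> D"
      using compact_support_bounded[OF cont(2) K(1)] by blast
    obtain C where C: "C \<ge> 0" "\<And>x. norm (\<phi> i x) \<le> C"
      using compact_support_bounded[OF cont(1) K(1,3)] by blast
    from C D have "\<bar>\<phi> i x\<bar> \<le> max C D \<and> norm (gradient (\<phi> i) x) \<le> max C D" for x
      by (simp add: le_max_iff_disj)
    with C(1) show ?thesis by (intro exI[of _ "max C D"]) auto
  qed
  then obtain C where C: "\<And>i. i \<in> I \<Longrightarrow> C i \<ge> 0" "\<And>i x. i \<in> I \<Longrightarrow> \<bar>\<phi> i x\<bar> \<le> C i"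
      "\<And>i x. i \<in> I \<Longrightarrow> norm (gradient (\<phi> i) x) \<le> C i" by metis
  define M where "M = (\<Sum>i\<in>I. C i)"
  have M0: "M \<ge> 0" unfolding M_def using C(1) by (intro sum_nonneg)
  have CM: "C i \<le> M" if "i \<in> I" for i
    unfolding M_def using that C(1) I by (intro member_le_sum) auto
  have \<phi>M: "\<bar>\<phi> i x\<bar> \<le> M" "norm (gradient (\<phi> i) x) \<le> M" if "i \<in> I" for i x
    using C(2,3)[OF that, of x] CM[OF that] by linarith+
  define B where "B = max M ((M\<^sup>2 + \<epsilon>\<^sup>2) powr (1 / 2))"
  have B0: "B \<ge> 0" using M0 by (simp add: B_def)
  have V: "norm (V w x) \<le> B" if w: "w \<in> simplex_weights I" for w x
  proof -
    have "V w x \<le> (M\<^sup>2 + \<epsilon>\<^sup>2) powr (1 / 2)"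
      by (rule V_le[OF w \<phi>M(1) M0])
    then show ?thesis using V_nonneg[OF w, of x] by (simp add: B_def)
  qed
  have gV: "norm (gradient (V w) x) \<le> B" if w: "w \<in> simplex_weights I" for w x
  proof -
    have "norm (gradient (V w) x) powr p \<le> (\<Sum>i\<in>I. w i * norm (gradient (\<phi> i) x) powr p)"
      by (rule gradient_V_powr_le[OF w])
    also have "\<dots> \<le> (\<Sum>i\<in>I. w i * M powr p)"
      using weights[OF w] \<phi>M(2) p by (intro sum_mono mult_left_mono powr_mono2) auto
    also have "\<dots> = M powr p" by (simp add: sum_distrib_right[symmetric] weights[OF w])
    finally have "norm (gradient (V w) x) \<le> M"
      using p M0 powr_less_mono2[of p M "norm (gradient (V w) x)"] by linarith
    then show ?thesis by (simp add: B_def)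
  qed
  have tri: "norm (a s *\<^sub>R v - a (neg s) *\<^sub>R w) \<le> A * B + A * B"
    if "s \<in> S" "norm v \<le> B" "norm w \<le> B" for s and v w :: "'b::real_normed_vector"
  proof -
    have "norm (a s *\<^sub>R v - a (neg s) *\<^sub>R w) \<le> a s * norm v + a (neg s) * norm w"
      using norm_triangle_ineq4[of "a s *\<^sub>R v" "a (neg s) *\<^sub>R w"] a(1) that neg(1) by simp
    also have "\<dots> \<le> A * B + A * B"
      using that a(1,2) neg(1) order_trans[OF a(1) a(2)] by (intro add_mono mult_mono) auto
    finally show ?thesis .
  qed
  show thesis
  proof (rule that)
    \<comment> \<open>\<open>A \<ge> 0\<close> follows only from a point of \<open>S\<close>, so
      \<open>max 0\<close> secures a nonnegative bound.\<close>
    show "norm (h0 s x) \<le> max 0 (A * B + A * B)" if "s \<in> S" for s x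
      using tri[OF that V[OF c(2)[OF that]] V[OF c(2)[OF neg(1)[OF that]]], of x x]
      by (simp add: h0_def le_max_iff_disj)
    show "norm (gradient (h0 s) x) \<le> max 0 (A * B + A * B)" if "s \<in> S" for s x
      using tri[OF that gV[OF c(2)[OF that]] gV[OF c(2)[OF neg(1)[OF that]]], of x x]
      by (simp add: gradient_h0[OF that] le_max_iff_disj)
  qed simp
qed

text \<open>Continuity of cutoffs and weights gives pointwise convergence of values and gradients.
  With uniform bounds on a bounded domain, dominated convergence yields convergence of the mass,
  hence of the normalising factor, and of both integrals in the norm.\<close>

lemma tendsto_W1p_norm_h:
  assumes X: "\<And>n. X n \<in> S" and s: "s \<in> S" and lim: "X \<longlonglongrightarrow> s"
  shows "(\<lambda>n. W1p_norm p \<Omega> (\<lambda>x. h (X n) x - h s x)) \<longlonglongrightarrow> 0"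
proof -
  have seq: "(\<lambda>n. f (X n)) \<longlonglongrightarrow> f s" if "continuous_on S f" for f :: "'s \<Rightarrow> 'c::topological_space"
    using continuous_on_tendsto_compose[OF that lim s] X by simp
  have neg_lim: "(\<lambda>n. neg (X n)) \<longlonglongrightarrow> neg s" by (rule seq[OF neg(3)])
  have seq': "(\<lambda>n. f (neg (X n))) \<longlonglongrightarrow> f (neg s)" if "continuous_on S f" for f :: "'s \<Rightarrow> 'c::topological_space"
    using continuous_on_tendsto_compose[OF that neg_lim neg(1)[OF s]] X neg(1) by simp
  have h0: "(\<lambda>n. h0 (X n) x) \<longlonglongrightarrow> h0 s x" for x
    unfolding h0_def
    by (intro tendsto_intros tendsto_V seq seq' a(3) c neg(1) X s)
  have gh0: "(\<lambda>n. gradient (h0 (X n)) x) \<longlonglongrightarrow> gradient (h0 s) x" for x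
    unfolding gradient_h0[OF X] gradient_h0[OF s]
    by (intro tendsto_intros tendsto_gradient_V seq seq' a(3) c neg(1) X s)
  obtain B where B: "B \<ge> 0" "\<And>s x. s \<in> S \<Longrightarrow> norm (h0 s x) \<le> B"
      "\<And>s x. s \<in> S \<Longrightarrow> norm (gradient (h0 s) x) \<le> B"
    using h0_bounded by blast
  have p0: "p > 0" using p by simp
  have mass: "(\<lambda>n. mass (X n)) \<longlonglongrightarrow> mass s"
    unfolding mass_def real_norm_def[symmetric]
    by (rule tendsto_integral_norm_powr[OF p0 \<Omega> _ _ B(2)[OF X] _ h0])
       (use X s in \<open>auto intro: test_functions_measurable[OF h0_test_function]
          test_function_eq_0[OF h0_test_function]\<close>)
  have coef: "(\<lambda>n. coef (X n)) \<longlonglongrightarrow> coef s"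
    unfolding coef_def using mass_pos[OF s] by (intro tendsto_intros mass) auto
  then have "Bseq (\<lambda>n. coef (X n))" by (rule convergent_imp_Bseq[OF convergentI])
  \<comment> \<open>A convergent sequence is bounded; \<open>D\<close> keeps the majorant of the
    differences uniform in \<open>n\<close>.\<close>
  then obtain D where D: "D > 0" "\<And>n. norm (coef (X n)) \<le> D" by (auto simp: Bseq_def)
  define d where "d n x = h (X n) x - h s x" for n x
  have d_test: "d n \<in> test_functions \<Omega>" for n
    unfolding d_def[abs_def] by (intro test_functions_diff h_test_function X s)
  have gd: "gradient (d n) x = coef (X n) *\<^sub>R gradient (h0 (X n)) x - coef s *\<^sub>R gradient (h0 s) x" for n x
  proof -
    have "h t differentiable (at x)" if "t \<in> S" for t
      using smooth_differentiable test_functions_smooth[OF h_test_function[OF that]] by blast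
    then show ?thesis
      unfolding d_def[abs_def] using X s by (simp add: gradient_diff gradient_h)
  qed
  have bd: "norm (coef (X n) *\<^sub>R v - coef s *\<^sub>R w) \<le> D * B + \<bar>coef s\<bar> * B"
    if "norm v \<le> B" "norm w \<le> B" for n and v w :: "'b::real_normed_vector"
  proof -
    have "norm (coef (X n) *\<^sub>R v - coef s *\<^sub>R w) \<le> \<bar>coef (X n)\<bar> * norm v + \<bar>coef s\<bar> * norm w"
      using norm_triangle_ineq4[of "coef (X n) *\<^sub>R v" "coef s *\<^sub>R w"] by simp
    also have "\<dots> \<le> D * B + \<bar>coef s\<bar> * B"
      using that D B(1) by (intro add_mono mult_mono) auto
    finally show ?thesis .
  qed
  have "(\<lambda>n. \<integral>x. norm (d n x) powr p \<partial>lborel) \<longlonglongrightarrow> (\<integral>x. norm (0::real) powr p \<partial>(lborel :: 'a measure))"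
  proof (rule tendsto_integral_norm_powr[OF p0 \<Omega>])
    show "norm (d n x) \<le> D * B + \<bar>coef s\<bar> * B" for n x
      using bd[of "h0 (X n) x" "h0 s x" n] B(2) X s by (simp add: d_def h_def)
    have "(\<lambda>n. d n x) \<longlonglongrightarrow> coef s * h0 s x - coef s * h0 s x" for x
      unfolding d_def h_def by (intro tendsto_intros coef h0)
    then show "(\<lambda>n. d n x) \<longlonglongrightarrow> 0" for x by simp
  qed (auto intro: test_functions_measurable[OF d_test] test_function_eq_0[OF d_test])
  moreover have "(\<lambda>n. \<integral>x. norm (gradient (d n) x) powr p \<partial>lborel) \<longlonglongrightarrow>
      (\<integral>x. norm (0::'a) powr p \<partial>(lborel :: 'a measure))"
  proof (rule tendsto_integral_norm_powr[OF p0 \<Omega>])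
    show "norm (gradient (d n) x) \<le> D * B + \<bar>coef s\<bar> * B" for n x
      using bd[of "gradient (h0 (X n)) x" "gradient (h0 s) x" n] B(3) X s by (simp add: gd)
    have "(\<lambda>n. gradient (d n) x) \<longlonglongrightarrow> coef s *\<^sub>R gradient (h0 s) x - coef s *\<^sub>R gradient (h0 s) x" for x
      unfolding gd by (intro tendsto_intros coef gh0)
    then show "(\<lambda>n. gradient (d n) x) \<longlonglongrightarrow> 0" for x by simp
  qed (auto intro: test_functions_measurable[OF d_test] gradient_test_function_eq_0[OF d_test])
  ultimately have "(\<lambda>n. (\<integral>x. norm (d n x) powr p \<partial>lborel) +
      (\<integral>x. norm (gradient (d n) x) powr p \<partial>lborel)) \<longlonglongrightarrow> 0 + 0"
    using p0 by (intro tendsto_add) auto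
  then have "(\<lambda>n. ((\<integral>x. norm (d n x) powr p \<partial>lborel) +
      (\<integral>x. norm (gradient (d n) x) powr p \<partial>lborel)) powr (1 / p)) \<longlonglongrightarrow> 0 powr (1 / p)"
    using p0 by (intro tendsto_powr') auto
  then show ?thesis
    using p \<Omega> by (simp add: W1p_norm_def d_def[symmetric] Lp_integral_test_function[OF _ _ _ d_test]
        dirichlet_energy_test_function[OF _ _ _ d_test])
qed

lemma continuous_map_h:
  "continuous_map (top_of_set S) (subtopology (W0p_topology p \<Omega>) (Lp_sphere p \<Omega>)) h"
  by (rule continuous_map_W0pI) (auto intro: h_Lp_sphere tendsto_W1p_norm_h)

end

subsection \<open>The ball and its half-balls\<close>

lemma open_half_ball: "open (half_ball x)"
proof -
  have "half_ball x = ball 0 1 \<inter> {z. x \<bullet> z > 0}"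
    by (auto simp: half_ball_def inner_commute)
  then show ?thesis by (simp add: open_Int open_halfspace_gt)
qed

lemma bounded_half_ball: "bounded (half_ball x)"
  by (rule bounded_subset[OF bounded_ball[of 0 1]]) (auto simp: half_ball_def)

text \<open>The linear functional attains a positive minimum on a nonempty compact set; half of it
  makes the inequality strict. This margin becomes the radius of the net.\<close>

lemma compact_subset_half_ball_gap:
  assumes K: "compact K" "K \<subseteq> half_ball x"
  obtains r where "r > 0" "\<And>z. z \<in> K \<Longrightarrow> z \<bullet> x > r"
proof (cases "K = {}")
  case False
  have "continuous_on K (\<lambda>z. z \<bullet> x)" by (intro continuous_intros)
  from continuous_attains_inf[OF K(1) False this]
  obtain z where z: "z \<in> K" "\<And>w. w \<in> K \<Longrightarrow> z \<bullet> x \<le> w \<bullet> x" by blast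
  have "z \<bullet> x > 0" using z K(2) by (auto simp: half_ball_def)
  show thesis
  proof (rule that[of "z \<bullet> x / 2"])
    show "w \<bullet> x > z \<bullet> x / 2" if "w \<in> K" for w
      using z(2)[OF that] \<open>z \<bullet> x > 0\<close> by linarith
  qed (use \<open>z \<bullet> x > 0\<close> in simp)
qed (use that[of 1] in simp)

lemma cogenus_eigenvalue_ball_le:
  fixes x :: "real ^ 'n"
  assumes p: "p > 1" and x: "norm x = 1" and \<phi>: "\<phi> \<in> test_functions (half_ball x)"
    and m: "0 < m" "m < (\<integral>z. \<bar>\<phi> z\<bar> powr p \<partial>lborel)"
  shows "cogenus_eigenvalue (CARD('n) + 1) p (ball (0 :: real ^ 'n) 1)
    \<le> ereal ((\<integral>z. norm (gradient \<phi> z) powr p \<partial>lborel) / m)"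
proof -
  let ?B = "ball (0 :: real ^ 'n) 1"
  define N where "N = CARD('n)"
  define S :: "(nat \<Rightarrow> real) set" where "S = {s. (\<Sum>i\<le>N. s i ^ 2) = 1 \<and> (\<forall>i>N. s i = 0)}"
  obtain b :: "'n \<Rightarrow> nat" where b: "bij_betw b UNIV {0..<N}"
    using ex_bij_betw_finite_nat[of "UNIV :: 'n set"] by (auto simp: N_def)
  \<comment> \<open>The coordinates below \<open>N\<close> form \<open>\<xi> s\<close>, and
    \<open>s N\<close> is the height t: \<open>S\<close> is the sphere of dimension N, in N + 1
    coordinates.\<close>
  define \<xi> :: "(nat \<Rightarrow> real) \<Rightarrow> real ^ 'n" where "\<xi> s = (\<chi> j. s (b j))" for s
  define neg :: "(nat \<Rightarrow> real) \<Rightarrow> nat \<Rightarrow> real" where "neg s = (\<lambda>i. - s i)" for s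
  have coord: "continuous_on S (\<lambda>s. s i)" for i
    by (rule continuous_on_subset[OF continuous_on_product_coordinates]) simp
  have \<xi>_neg: "\<xi> (neg s) = - \<xi> s" for s
    by (simp add: \<xi>_def neg_def vec_eq_iff)
  have \<xi>_0: "\<bar>s N\<bar> = 1" if "s \<in> S" "\<xi> s = 0" for s
  proof -
    have "s i = 0" if "i < N" for i
    proof -
      have "i \<in> b ` UNIV" using b that by (simp add: bij_betw_def)
      then obtain j where "i = b j" by blast
      then show ?thesis using \<open>\<xi> s = 0\<close> by (simp add: \<xi>_def vec_eq_iff)
    qed
    then have "(\<Sum>i\<le>N. s i ^ 2) = s N ^ 2"
      by (simp add: lessThan_Suc_atMost[symmetric])
    with that(1) show ?thesis by (auto simp: S_def power2_eq_1_iff)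
  qed
  have sN: "s N \<le> 1" if "s \<in> S" for s
  proof -
    have "s N ^ 2 \<le> (\<Sum>i\<le>N. s i ^ 2)" by (rule member_le_sum) auto
    with that have "s N ^ 2 \<le> 1" by (simp add: S_def)
    then show ?thesis by (simp add: abs_square_le_1 abs_le_iff)
  qed

  obtain K where K: "compact K" "K \<subseteq> half_ball x" "\<And>z. z \<notin> K \<Longrightarrow> \<phi> z = 0"
    using \<phi> by (rule test_functions_support) blast
  obtain r where r: "r > 0" "\<And>z. z \<in> K \<Longrightarrow> z \<bullet> x > r"
    by (rule compact_subset_half_ball_gap[OF K(1,2)]) blast
  obtain Y where Y: "Y \<subseteq> sphere (0 :: real ^ 'n) 1" "finite Y" "sphere 0 1 \<subseteq> (\<Union>y\<in>Y. ball y r)"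
  proof (rule compactE_image[of "sphere (0 :: real ^ 'n) 1" "sphere 0 1" "\<lambda>y. ball y r"])
    show "sphere 0 1 \<subseteq> (\<Union>y\<in>sphere (0 :: real ^ 'n) 1. ball y r)" using r(1) by auto
  qed auto
  obtain y1 where y1: "y1 \<in> Y" using Y(3) x by auto
  \<comment> \<open>The rotations are picked one by one for the finitely many \<open>y\<close>;
    nothing relates those of neighbouring directions.\<close>
  have "\<forall>y\<in>Y. \<exists>R. orthogonal_transformation R \<and> R y = x"
  proof
    fix y assume "y \<in> Y"
    then have "norm y = norm x" using Y(1) x by auto
    then show "\<exists>R. orthogonal_transformation R \<and> R y = x"
      by (rule orthogonal_transformation_exists) blast
  qed
  then obtain R where R: "\<And>y. y \<in> Y \<Longrightarrow> orthogonal_transformation (R y)" "\<And>y. y \<in> Y \<Longrightarrow> R y y = x"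
    by metis
  define \<psi> where "\<psi> y z = \<phi> (R y z)" for y z
  have R_lin: "linear (R y)" and R_norm: "norm (R y z) = norm z"
    and R_inner: "R y z \<bullet> R y w = z \<bullet> w" if "y \<in> Y" for y z w
    using R(1)[OF that] orthogonal_transformation_norm[OF R(1)[OF that]]
    by (auto simp: orthogonal_transformation_def)
  have \<psi>_supp: "norm z < 1" "z \<bullet> y > r" if "y \<in> Y" "R y z \<in> K" for y z
  proof -
    have "norm (R y z) < 1" using K(2) that(2) by (auto simp: half_ball_def)
    then show "norm z < 1" by (simp add: R_norm[OF that(1)])
    show "z \<bullet> y > r"
      using r(2)[OF that(2)] R_inner[OF that(1), of z y] R(2)[OF that(1)] by simp
  qed
  have \<psi>: "\<psi> y \<in> test_functions ?B" if y: "y \<in> Y" for y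
  proof (rule test_functionsI)
    show "continuously_differentiable n (\<psi> y)" for n
      unfolding \<psi>_def[abs_def]
      by (rule continuously_differentiable_compose_linear[OF R_lin[OF y] test_functions_smooth[OF \<phi>]])
    have "continuous_on UNIV (R y)"
      using R_lin[OF y] by (intro linear_continuous_on) (simp add: linear_conv_bounded_linear)
    then have "closed (R y -` K)"
      using K(1) by (intro closed_vimage compact_imp_closed)
    moreover have "R y -` K \<subseteq> ?B" using \<psi>_supp(1)[OF y] by auto
    moreover have "bounded (R y -` K)" by (rule bounded_subset[OF bounded_ball \<open>R y -` K \<subseteq> ?B\<close>])
    ultimately show "compact (R y -` K)" "R y -` K \<subseteq> ?B" by (auto simp: compact_eq_bounded_closed)
    show "\<psi> y z = 0" if "z \<notin> R y -` K" for z using K(3) that by (simp add: \<psi>_def)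
  qed
  have \<psi>_nz: "norm z < 1" "z \<bullet> y > r" if "y \<in> Y" "\<psi> y z \<noteq> 0" for y z
    using \<psi>_supp[OF that(1), of z] K(3)[of "R y z"] that(2) by (auto simp: \<psi>_def)
  note \<phi>_meas = test_functions_measurable[OF \<phi>]
  have \<psi>_mass: "(\<integral>z. \<bar>\<psi> y z\<bar> powr p \<partial>lborel) = (\<integral>z. \<bar>\<phi> z\<bar> powr p \<partial>lborel)" if "y \<in> Y" for y
    unfolding \<psi>_def
    using integral_lborel_orthogonal[OF R(1)[OF that], of "\<lambda>z. \<bar>\<phi> z\<bar> powr p"] \<phi>_meas by simp
  have "\<phi> differentiable (at z)" for z
    by (rule smooth_differentiable[OF test_functions_smooth[OF \<phi>, of "Suc 0"]])
  then have \<psi>_energy: "(\<integral>z. norm (gradient (\<psi> y) z) powr p \<partial>lborel) =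
      (\<integral>z. norm (gradient \<phi> z) powr p \<partial>lborel)" if "y \<in> Y" for y
    unfolding \<psi>_def[abs_def]
    using integral_lborel_orthogonal[OF R(1)[OF that], of "\<lambda>z. norm (gradient \<phi> z) powr p"] \<phi>_meas
    by (simp add: gradient_compose_orthogonal[OF _ R(1)[OF that]])
  obtain \<epsilon> where \<epsilon>: "\<epsilon> > 0" "\<And>w. w \<in> simplex_weights Y \<Longrightarrow>
      m \<le> (\<integral>z. \<bar>power_mean p \<epsilon> Y \<psi> w z\<bar> powr p \<partial>lborel)"
    by (rule power_mean_mass_ge[OF p Y(2) open_ball bounded_ball \<psi> \<psi>_mass m]) blast+

  \<comment> \<open>\<open>a s\<close> and \<open>a (neg s)\<close> are both positive exactly when
    \<open>\<bar>s N\<bar> < 1 / 2\<close>, and one of them always is.\<close>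
  define a :: "(nat \<Rightarrow> real) \<Rightarrow> real" where "a s = max 0 (s N + 1 / 2)" for s
  \<comment> \<open>For \<open>\<xi> s \<noteq> 0\<close> the first summand is positive exactly when
    the direction of \<open>\<xi> s\<close> is within \<open>r\<close> of \<open>y\<close>; the
    factor \<open>norm (\<xi> s)\<close> makes it continuous also at \<open>\<xi> s = 0\<close>.
    There it is 0 for every \<open>y\<close>, and the second summand, attached to an arbitrary
    \<open>y1\<close>, keeps the total positive without touching the zone
    \<open>\<bar>s N\<bar> < 1 / 2\<close>.\<close>
  define wt where "wt y s = max 0 (r * norm (\<xi> s) - norm (\<xi> s - norm (\<xi> s) *\<^sub>R y)) +
    (if y = y1 then max 0 (\<bar>s N\<bar> - 1 / 2) else 0)" for y s
  define c where "c s y = wt y s / (\<Sum>y\<in>Y. wt y s)" for s y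
  have wt_nonneg: "wt y s \<ge> 0" for y s by (simp add: wt_def)
  have wt_sum: "(\<Sum>y\<in>Y. wt y s) > 0" if s: "s \<in> S" for s
  proof -
    have "\<exists>y\<in>Y. wt y s > 0"
    proof (cases "\<xi> s = 0")
      case True
      then show ?thesis using y1 \<xi>_0[OF s True] by (intro bexI[of _ y1]) (auto simp: wt_def)
    next
      case False
      then have "inverse (norm (\<xi> s)) *\<^sub>R \<xi> s \<in> sphere 0 1" by simp
      then obtain y where y: "y \<in> Y" "dist y (inverse (norm (\<xi> s)) *\<^sub>R \<xi> s) < r"
        using Y(3) by fastforce
      have "\<xi> s - norm (\<xi> s) *\<^sub>R y = norm (\<xi> s) *\<^sub>R (inverse (norm (\<xi> s)) *\<^sub>R \<xi> s - y)"
        using False by (simp add: scaleR_diff_right)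
      then have "norm (\<xi> s - norm (\<xi> s) *\<^sub>R y) = norm (\<xi> s) * dist y (inverse (norm (\<xi> s)) *\<^sub>R \<xi> s)"
        by (simp add: dist_norm norm_minus_commute)
      also have "\<dots> < norm (\<xi> s) * r" using y(2) False by (intro mult_strict_left_mono) auto
      finally have "wt y s > 0"
        by (auto simp: wt_def mult.commute intro!: add_pos_nonneg)
      with y(1) show ?thesis by blast
    qed
    then show ?thesis using Y(2) wt_nonneg by (auto intro: sum_pos2)
  qed
  have \<xi>_cont: "continuous_on S \<xi>"
    unfolding \<xi>_def[abs_def] by (intro continuous_on_vec_lambda coord)
  have wt_cont: "continuous_on S (wt y)" for y
    unfolding wt_def[abs_def]
    by (cases "y = y1") (auto intro!: continuous_intros \<xi>_cont coord)
  \<comment> \<open>As \<open>norm z < 1\<close>, replacing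
    \<open>norm (\<xi> s) *\<^sub>R y\<close> by \<open>\<xi> s\<close> changes the inner product
    with \<open>z\<close> by less than \<open>r * norm (\<xi> s)\<close>, while
    \<open>z \<bullet> y > r\<close>.\<close>
  have direction: "z \<bullet> \<xi> s > 0"
    if "s \<in> S" "\<bar>s N\<bar> < 1 / 2" "y \<in> Y" "c s y > 0" "\<psi> y z \<noteq> 0" for s y z
  proof -
    have "wt y s > 0"
      using that(4) wt_sum[OF that(1)] by (simp add: c_def zero_less_divide_iff)
    then have lt: "norm (\<xi> s - norm (\<xi> s) *\<^sub>R y) < r * norm (\<xi> s)"
      using that(2) by (auto simp: wt_def split: if_splits)
    then have "r * norm (\<xi> s) > 0" using norm_ge_zero order.strict_trans1 by blast
    then have \<xi>: "norm (\<xi> s) > 0" using r(1) by (simp add: zero_less_mult_iff)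
    have "\<bar>z \<bullet> (\<xi> s - norm (\<xi> s) *\<^sub>R y)\<bar> \<le> norm z * norm (\<xi> s - norm (\<xi> s) *\<^sub>R y)"
      by (rule Cauchy_Schwarz_ineq2)
    also have "\<dots> \<le> 1 * norm (\<xi> s - norm (\<xi> s) *\<^sub>R y)"
      using \<psi>_nz(1)[OF that(3,5)] by (intro mult_right_mono) auto
    finally have "z \<bullet> \<xi> s - norm (\<xi> s) * (z \<bullet> y) > - (r * norm (\<xi> s))"
      using lt by (simp add: inner_diff_right)
    moreover have "norm (\<xi> s) * (z \<bullet> y) > norm (\<xi> s) * r"
      using \<psi>_nz(2)[OF that(3,5)] \<xi> by simp
    ultimately show ?thesis by (simp add: mult.commute)
  qed
  have neg_S: "neg s \<in> S" if "s \<in> S" for s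
    using that by (simp add: S_def neg_def)

  \<comment> \<open>The bound 3/2 on the cutoff comes from \<open>s N \<le> 1\<close>.\<close>
  interpret sphere_family p \<epsilon> Y \<psi> "?B" S neg a c "3 / 2"
    "\<integral>z. norm (gradient \<phi> z) powr p \<partial>lborel" m
  proof unfold_locales
    show "continuous_on S neg"
      unfolding neg_def[abs_def]
      by (intro continuous_on_coordinatewise_then_product continuous_intros coord)
    show "continuous_on S a"
      unfolding a_def[abs_def] by (intro continuous_intros coord)
    show "a s > 0 \<or> a (neg s) > 0" for s
      by (auto simp: a_def neg_def)
    show "a s \<le> 3 / 2" if "s \<in> S" for s
      using sN[OF that] by (auto simp: a_def max_def)
    show "continuous_on S (\<lambda>s. c s y)" for y
      unfolding c_def by (intro continuous_intros wt_cont) (auto simp: less_imp_neq[OF wt_sum, THEN not_sym])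
    show "c s \<in> simplex_weights Y" if "s \<in> S" for s
      using wt_sum[OF that] wt_nonneg
      by (auto simp: simplex_weights_def c_def sum_divide_distrib[symmetric])
    show "\<psi> j z = 0"
      if "s \<in> S" "a s > 0" "a (neg s) > 0" "i \<in> Y" "j \<in> Y" "c s i > 0" "c (neg s) j > 0" "\<psi> i z \<noteq> 0"
      for s i j z
    proof (rule ccontr)
      assume "\<psi> j z \<noteq> 0"
      have "\<bar>s N\<bar> < 1 / 2" "\<bar>neg s N\<bar> < 1 / 2"
        using that(2,3) by (auto simp: a_def neg_def abs_if)
      then have "z \<bullet> \<xi> s > 0" "z \<bullet> \<xi> (neg s) > 0"
        using direction that neg_S \<open>\<psi> j z \<noteq> 0\<close> by blast+
      then show False by (simp add: \<xi>_neg)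
    qed
  qed (use p \<epsilon> Y(2) \<psi> \<psi>_energy m neg_S in \<open>auto simp: a_def neg_def\<close>)

  have nsphere: "nsphere (N + 1 - 1) = top_of_set S"
    by (simp add: nsphere_top_of_set S_def)
  have "h \<in> odd_maps (N + 1) p ?B"
    using continuous_map_h h_neg unfolding odd_maps_def nsphere by (auto simp: neg_def)
  then have "cogenus_eigenvalue (N + 1) p ?B \<le> (SUP u\<in>h ` S. ereal (dirichlet_energy p ?B u))"
    unfolding cogenus_eigenvalue_def nsphere by (intro INF_lower2[of h]) auto
  also have "\<dots> \<le> ereal ((\<integral>z. norm (gradient \<phi> z) powr p \<partial>lborel) / m)"
    using dirichlet_energy_h by (intro SUP_least) auto
  finally show ?thesis by (simp add: N_def)
qed

text \<open>The estimate holds for every competitor on the half-ball: letting the approximation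
  error tend to 0 removes the losses in mass and energy together.\<close>

lemma cogenus_eigenvalue_ball_le_energy:
  fixes x :: "real ^ 'n"
  assumes p: "p > 1" and x: "norm x = 1" and u: "u \<in> Lp_sphere p (half_ball x)"
  shows "cogenus_eigenvalue (CARD('n) + 1) p (ball (0 :: real ^ 'n) 1)
    \<le> ereal (dirichlet_energy p (half_ball x) u)"
proof -
  let ?E = "dirichlet_energy p (half_ball x) u"
  let ?ev = "cogenus_eigenvalue (CARD('n) + 1) p (ball (0 :: real ^ 'n) 1)"
  define d where "d n = inverse (real (Suc n))" for n
  \<comment> \<open>The mass of \<open>\<phi>\<close> is at least \<open>1 - d n\<close>; the bound
    \<open>m = 1 - 2 * d n\<close> lies strictly below it and is positive from \<open>n = 2\<close>
    on.\<close>
  have le: "?ev \<le> ereal ((?E + d n) / (1 - 2 * d n))" if n: "n \<ge> 2" for n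
  proof -
    have d: "d n > 0" "2 * d n < 1" using n by (auto simp: d_def field_simps)
    obtain \<phi> where \<phi>: "\<phi> \<in> test_functions (half_ball x)" "(\<integral>z. \<bar>\<phi> z\<bar> powr p \<partial>lborel) \<ge> 1 - d n"
        "(\<integral>z. norm (gradient \<phi> z) powr p \<partial>lborel) \<le> ?E + d n"
      by (rule Lp_sphere_approx[OF open_half_ball bounded_half_ball p u d(1)])
    have "?ev \<le> ereal ((\<integral>z. norm (gradient \<phi> z) powr p \<partial>lborel) / (1 - 2 * d n))"
      using d \<phi>(2) by (intro cogenus_eigenvalue_ball_le[OF p x \<phi>(1)]) auto
    also have "\<dots> \<le> ereal ((?E + d n) / (1 - 2 * d n))"
      using d \<phi>(3) by (simp add: divide_right_mono)
    finally show ?thesis .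
  qed
  have "(\<lambda>n. (?E + d n) / (1 - 2 * d n)) \<longlonglongrightarrow> (?E + 0) / (1 - 2 * 0)"
    unfolding d_def by (intro tendsto_intros LIMSEQ_inverse_real_of_nat) auto
  then have "(\<lambda>n. ereal ((?E + d n) / (1 - 2 * d n))) \<longlonglongrightarrow> ereal ?E" by simp
  then show ?thesis using le by (intro LIMSEQ_le_const[of _ "ereal ?E"] exI[of _ 2]) blast+
qed

theorem lemma4p1:
  fixes p :: real
  assumes "CARD('n::finite) \<ge> 2" and "1 < p"
  shows "(\<forall>k\<in>{2..CARD('n)}.
            cogenus_eigenvalue k p (ball (0 :: real ^ 'n) 1)
              \<le> cogenus_eigenvalue (k + 1) p (ball (0 :: real ^ 'n) 1)) \<and>
         (\<forall>x\<in>sphere (0 :: real ^ 'n) 1.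
            cogenus_eigenvalue (CARD('n) + 1) p (ball (0 :: real ^ 'n) 1) \<le> lambda_ominus p x)"
proof (intro conjI ballI)
  fix k assume "k \<in> {2..CARD('n)}"
  then show "cogenus_eigenvalue k p (ball (0 :: real ^ 'n) 1)
      \<le> cogenus_eigenvalue (k + 1) p (ball (0 :: real ^ 'n) 1)"
    by (intro cogenus_eigenvalue_mono) auto
next
  fix x assume "x \<in> sphere (0 :: real ^ 'n) 1"
  then have x: "norm x = 1" by simp
  show "cogenus_eigenvalue (CARD('n) + 1) p (ball (0 :: real ^ 'n) 1) \<le> lambda_ominus p x"
    unfolding lambda_ominus_def cogenus_eigenvalue_def[of 1]
  proof (rule INF_greatest)
    fix h assume h: "h \<in> odd_maps 1 p (half_ball x)"
    \<comment> \<open>The value of \<open>h\<close> at either point of the two-point sphere is a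
      competitor whose energy is at most the supremum over both.\<close>
    obtain s where s: "s \<in> topspace (nsphere 0)" using in_topspace_nsphere by blast
    have "h s \<in> Lp_sphere p (half_ball x)"
      using h s unfolding odd_maps_def continuous_map_in_subtopology by auto
    then have "cogenus_eigenvalue (CARD('n) + 1) p (ball (0 :: real ^ 'n) 1)
        \<le> ereal (dirichlet_energy p (half_ball x) (h s))"
      by (rule cogenus_eigenvalue_ball_le_energy[OF assms(2) x])
    also have "\<dots> \<le> (SUP u\<in>h ` topspace (nsphere (1 - 1)). ereal (dirichlet_energy p (half_ball x) u))"
      using s by (intro SUP_upper2[of "h s"]) auto
    finally show "cogenus_eigenvalue (CARD('n) + 1) p (ball (0 :: real ^ 'n) 1)
        \<le> (SUP u\<in>h ` topspace (nsphere (1 - 1)). ereal (dirichlet_energy p (half_ball x) u))" .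
  qed
qed

end
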